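(* Let $\mathcal{K}$ be a complex Hilbert space and let $\{C_j\}_{j\in J}$ be a set of operators in $B(\mathcal{K})$ with $\|C_j\|=1$ for all $j$. Then the set $\{C_j\}_{j\in J}$ is column orthogonal if and only if $\sum_{j} C_jC_j^*\le I$ and there exists a state $\omega$ on $B(\mathcal{K})$ (or, equivalently, on the C$^*$-algebra generated by all the $C_j$) such that $\omega(C_j^*C_j)=1$ for all $j\in J$. (The last condition just means that in the cyclic representation $\pi$ arising from $\omega$ the operators $\pi(C_j)$ all attain their norms $1$ at the same unit vector $\eta$, namely at a cyclic vector for $\pi$ with $\omega(T)=\langle\pi(T)\eta,\eta\rangle$ for all $T$.)
   Context: A state on a C$^*$-algebra is a positive linear functional of norm $1$. If $J$ is infinite, $\sum_j C_jC_j^*\le I$ means that all finite partial sums are $\le I$. The tensor product $M_n(\mathbb{C})\otimes B(\mathcal{K})$ carries the C$^*$-norm coming from the natural identification with $M_n(B(\mathcal{K}))\cong B(\mathcal{K}^n)$. Definition (column orthogonal). A finite set of operators $B_j\in B(\mathcal{K})$ is called column orthogonal if at least one of the operators is $0$, or the operators $C_j:=\|B_j\|^{-1}B_j$ satisfy $$\Big\|\sum_j\alpha_j\otimes C_j\Big\|^2=\Big\|\sum_j\alpha_j^*\alpha_j\Big\|$$ for all $\alpha_j\in M_n(\mathbb{C})$ and all $n\in\mathbb{N}$. A general set of operators in $B(\mathcal{K})$ is column orthogonal if all of its finite subsets are column orthogonal. *)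

theory Defs
  imports "HOL-Analysis.Analysis"
begin

section \<open>Complex Hilbert spaces\<close>

text \<open>
  The norm, metric and completeness are those of the class \<^class>\<open>banach\<close>; the complex structure
  and the inner product are added on top and tied to them by the last axioms.
  The inner product is linear in its first argument.
\<close>

class chilbert_space = banach +
  fixes scaleC :: "complex \<Rightarrow> 'a \<Rightarrow> 'a" (infixr "*\<^sub>C" 75)
    and cinner :: "'a \<Rightarrow> 'a \<Rightarrow> complex"
  assumes scaleC_add_right: "c *\<^sub>C (x + y) = c *\<^sub>C x + c *\<^sub>C y"
    and scaleC_add_left: "(c + d) *\<^sub>C x = c *\<^sub>C x + d *\<^sub>C x"
    and scaleC_scaleC: "c *\<^sub>C d *\<^sub>C x = (c * d) *\<^sub>C x"
    and scaleC_of_real: "complex_of_real r *\<^sub>C x = r *\<^sub>R x"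
    and cinner_add_left: "cinner (x + y) z = cinner x z + cinner y z"
    and cinner_scaleC_left: "cinner (c *\<^sub>C x) y = c * cinner x y"
    and cinner_commute: "cinner x y = cnj (cinner y x)"
    and cinner_ge_zero: "0 \<le> Re (cinner x x)"
    and norm_eq_sqrt_cinner: "norm x = sqrt (Re (cinner x x))"

lemma cinner_scaleC_right: "cinner x (c *\<^sub>C y) = cnj c * cinner x y"
  by (metis cinner_commute cinner_scaleC_left complex_cnj_mult)

lemma norm_scaleC: "norm (c *\<^sub>C x) = cmod c * norm (x :: 'a::chilbert_space)"
proof -
  have "cinner (c *\<^sub>C x) (c *\<^sub>C x) = complex_of_real ((cmod c)\<^sup>2) * cinner x x"
    by (simp only: cinner_scaleC_left cinner_scaleC_right complex_norm_square ac_simps)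
  then have "Re (cinner (c *\<^sub>C x) (c *\<^sub>C x)) = (cmod c)\<^sup>2 * Re (cinner x x)"
    by simp
  then show ?thesis
    by (simp add: norm_eq_sqrt_cinner real_sqrt_mult)
qed


section \<open>Bounded operators\<close>

text \<open>
  \<^typ>\<open>'a \<Rightarrow>\<^sub>L 'a\<close> consists of the bounded real-linear maps, with the operator norm; \<open>B(K)\<close> is
  its subset of complex-linear maps.
\<close>

definition bounded_ops :: "('a::chilbert_space \<Rightarrow>\<^sub>L 'a) set" where
  "bounded_ops = {T :: 'a \<Rightarrow>\<^sub>L 'a. \<forall>c x. T (c *\<^sub>C x) = c *\<^sub>C T x}"

lift_definition scaleC_op :: "complex \<Rightarrow> ('b::real_normed_vector \<Rightarrow>\<^sub>L 'a) \<Rightarrow> ('b \<Rightarrow>\<^sub>L 'a::chilbert_space)"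
  is "\<lambda>c T x. c *\<^sub>C T x"
proof -
  fix c :: complex and T :: "'b \<Rightarrow> 'a"
  assume T: "bounded_linear T"
  then obtain K where K: "\<And>x. norm (T x) \<le> norm x * K"
    using bounded_linear.bounded by blast
  show "bounded_linear (\<lambda>x. c *\<^sub>C T x)"
  proof (rule bounded_linear_intro)
    show "c *\<^sub>C T (x + y) = c *\<^sub>C T x + c *\<^sub>C T y" for x y
      using T by (simp add: linear_simps scaleC_add_right)
    show "c *\<^sub>C T (r *\<^sub>R x) = r *\<^sub>R (c *\<^sub>C T x)" for r x
      using T by (simp add: linear_simps scaleC_scaleC mult.commute flip: scaleC_of_real)
    show "norm (c *\<^sub>C T x) \<le> norm x * (K * cmod c)" for x
      using mult_left_mono[OF K[of x] norm_ge_zero[of c]] by (simp add: norm_scaleC ac_simps)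
  qed
qed

text \<open>Existence is the Riesz representation theorem; uniqueness is definiteness of the inner product.\<close>

definition adj :: "('a::chilbert_space \<Rightarrow>\<^sub>L 'a) \<Rightarrow> ('a \<Rightarrow>\<^sub>L 'a)" where
  "adj T = (THE S. S \<in> bounded_ops \<and> (\<forall>x y. cinner (T x) y = cinner x (S y)))"

definition op_le :: "('a::chilbert_space \<Rightarrow>\<^sub>L 'a) \<Rightarrow> ('a \<Rightarrow>\<^sub>L 'a) \<Rightarrow> bool" where
  "op_le S T \<longleftrightarrow> (\<forall>x. cinner ((T - S) x) x \<in> \<real>\<^sub>\<ge>\<^sub>0)"


section \<open>C*-algebras of operators and states\<close>

definition cstar_subalgebra :: "('a::chilbert_space \<Rightarrow>\<^sub>L 'a) set \<Rightarrow> bool" where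
  "cstar_subalgebra A \<longleftrightarrow>
     A \<subseteq> bounded_ops \<and> 0 \<in> A \<and> closed A \<and>
     (\<forall>S\<in>A. \<forall>T\<in>A. S + T \<in> A \<and> S o\<^sub>L T \<in> A) \<and>
     (\<forall>c. \<forall>T\<in>A. scaleC_op c T \<in> A) \<and>
     (\<forall>T\<in>A. adj T \<in> A)"

text \<open>The generated C*-algebra is not required to contain the identity operator.\<close>

definition cstar_generated :: "('a::chilbert_space \<Rightarrow>\<^sub>L 'a) set \<Rightarrow> ('a \<Rightarrow>\<^sub>L 'a) set" where
  "cstar_generated X = \<Inter> {A. cstar_subalgebra A \<and> X \<subseteq> A}"

text \<open>
  A functional on \<open>A\<close> is represented by a function on the whole operator type of which only the
  values on \<open>A\<close> matter. Boundedness is explicit, since \<^const>\<open>Sup\<close> is unspecified on unbounded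
  sets of reals.
\<close>

definition is_state :: "('a::chilbert_space \<Rightarrow>\<^sub>L 'a) set \<Rightarrow> (('a \<Rightarrow>\<^sub>L 'a) \<Rightarrow> complex) \<Rightarrow> bool" where
  "is_state A \<omega> \<longleftrightarrow>
     (\<forall>S\<in>A. \<forall>T\<in>A. \<omega> (S + T) = \<omega> S + \<omega> T) \<and>
     (\<forall>c. \<forall>T\<in>A. \<omega> (scaleC_op c T) = c * \<omega> T) \<and>
     (\<forall>T\<in>A. \<omega> (adj T o\<^sub>L T) \<in> \<real>\<^sub>\<ge>\<^sub>0) \<and>
     bdd_above ((\<lambda>T. cmod (\<omega> T)) ` {T \<in> A. norm T \<le> 1}) \<and>
     (SUP T\<in>{T \<in> A. norm T \<le> 1}. cmod (\<omega> T)) = 1"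

definition representation ::
  "('a::chilbert_space \<Rightarrow>\<^sub>L 'a) set \<Rightarrow> (('a \<Rightarrow>\<^sub>L 'a) \<Rightarrow> ('h::chilbert_space \<Rightarrow>\<^sub>L 'h)) \<Rightarrow> bool" where
  "representation A \<pi> \<longleftrightarrow>
     (\<forall>T\<in>A. \<pi> T \<in> bounded_ops) \<and>
     (\<forall>S\<in>A. \<forall>T\<in>A. \<pi> (S + T) = \<pi> S + \<pi> T \<and> \<pi> (S o\<^sub>L T) = \<pi> S o\<^sub>L \<pi> T) \<and>
     (\<forall>c. \<forall>T\<in>A. \<pi> (scaleC_op c T) = scaleC_op c (\<pi> T)) \<and>
     (\<forall>T\<in>A. \<pi> (adj T) = adj (\<pi> T))"

text \<open>
  The cyclic (GNS) representation arising from \<open>\<omega>\<close>, with its unit cyclic vector \<open>\<eta>\<close>; it is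
  determined by these properties up to unitary equivalence.
\<close>

definition cyclic_representation_of ::
  "('a::chilbert_space \<Rightarrow>\<^sub>L 'a) set \<Rightarrow> (('a \<Rightarrow>\<^sub>L 'a) \<Rightarrow> complex) \<Rightarrow>
   (('a \<Rightarrow>\<^sub>L 'a) \<Rightarrow> ('h::chilbert_space \<Rightarrow>\<^sub>L 'h)) \<Rightarrow> 'h \<Rightarrow> bool" where
  "cyclic_representation_of A \<omega> \<pi> \<eta> \<longleftrightarrow>
     representation A \<pi> \<and> norm \<eta> = 1 \<and>
     closure ((\<lambda>T. \<pi> T \<eta>) ` A) = UNIV \<and>
     (\<forall>T\<in>A. \<omega> T = cinner (\<pi> T \<eta>) \<eta>)"


section \<open>Matrices of operators and column orthogonality\<close>

text \<open>
  An n-by-n matrix is a function of two indices of which only the values below n matter. The norm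
  of a matrix over \<open>B(K)\<close> is its norm as an operator on the n-fold Hilbert space direct sum of \<open>K\<close>.
\<close>

definition opmat_norm :: "nat \<Rightarrow> (nat \<Rightarrow> nat \<Rightarrow> ('a::real_normed_vector \<Rightarrow>\<^sub>L 'a)) \<Rightarrow> real" where
  "opmat_norm n T =
     (SUP x\<in>{x. L2_set (\<lambda>k. norm (x k)) {..<n} \<le> 1}.
        L2_set (\<lambda>i. norm (\<Sum>k<n. T i k (x k))) {..<n})"

text \<open>The complex scalar case: a matrix acting on the n-dimensional complex Euclidean space.\<close>

definition cmat_norm :: "nat \<Rightarrow> (nat \<Rightarrow> nat \<Rightarrow> complex) \<Rightarrow> real" where
  "cmat_norm n \<alpha> = opmat_norm n (\<lambda>i k. blinfun_mult_right (\<alpha> i k))"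

definition cmat_adj :: "(nat \<Rightarrow> nat \<Rightarrow> complex) \<Rightarrow> (nat \<Rightarrow> nat \<Rightarrow> complex)" where
  "cmat_adj \<alpha> = (\<lambda>i k. cnj (\<alpha> k i))"

definition cmat_mult ::
  "nat \<Rightarrow> (nat \<Rightarrow> nat \<Rightarrow> complex) \<Rightarrow> (nat \<Rightarrow> nat \<Rightarrow> complex) \<Rightarrow> (nat \<Rightarrow> nat \<Rightarrow> complex)" where
  "cmat_mult n \<alpha> \<beta> = (\<lambda>i k. \<Sum>l<n. \<alpha> i l * \<beta> l k)"

text \<open>The elementary tensor of \<open>\<alpha>\<close> and \<open>T\<close>, as a matrix over \<open>B(K)\<close>.\<close>

definition mat_tensor ::
  "(nat \<Rightarrow> nat \<Rightarrow> complex) \<Rightarrow> ('a::chilbert_space \<Rightarrow>\<^sub>L 'a) \<Rightarrow> (nat \<Rightarrow> nat \<Rightarrow> ('a \<Rightarrow>\<^sub>L 'a))" where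
  "mat_tensor \<alpha> T = (\<lambda>i k. scaleC_op (\<alpha> i k) T)"

text \<open>Families are indexed, so an operator occurring at two indices counts twice.\<close>

definition column_orthogonal_finite :: "'j set \<Rightarrow> ('j \<Rightarrow> ('a::chilbert_space \<Rightarrow>\<^sub>L 'a)) \<Rightarrow> bool" where
  "column_orthogonal_finite F B \<longleftrightarrow>
     (\<exists>j\<in>F. B j = 0) \<or>
     (\<forall>n (\<alpha> :: 'j \<Rightarrow> nat \<Rightarrow> nat \<Rightarrow> complex).
        (opmat_norm n (\<lambda>i k. \<Sum>j\<in>F. mat_tensor (\<alpha> j) (inverse (norm (B j)) *\<^sub>R B j) i k))\<^sup>2
        = cmat_norm n (\<lambda>i k. \<Sum>j\<in>F. cmat_mult n (cmat_adj (\<alpha> j)) (\<alpha> j) i k))"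

definition column_orthogonal :: "'j set \<Rightarrow> ('j \<Rightarrow> ('a::chilbert_space \<Rightarrow>\<^sub>L 'a)) \<Rightarrow> bool" where
  "column_orthogonal J B \<longleftrightarrow> (\<forall>F. finite F \<and> F \<subseteq> J \<longrightarrow> column_orthogonal_finite F B)"

end

(*
  Both sides are governed by the existence, for every finite subfamily F and e > 0, of a unit vector x
  with |C_j x|^2 > 1 - e for all j in F. States give such vectors because |sum C_j^* C_j| = card F;
  conversely a cluster point of the vector states is a state with value 1 at every C_j^* C_j.
  If also sum C_j C_j^* <= 1, the vectors C_j x are asymptotically orthonormal, since C_j^* C_j x is
  close to x and leaves no room for C_i^* C_j x, i different from j; testing at vectors with
  entries c_k x gives the lower bound for |sum alpha_j (x) C_j|, and the row contraction the upper bound.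
  Conversely, matrix units for alpha_j arrange the C_j in a row or in a column, which yields the two
  conditions.
*)
theory Submission
  imports Defs
begin

section \<open>Inner products\<close>

text \<open>The operators C_j need not attain their norms, hence the approximate, finite form of the
  norming condition; compactness of a set of functionals restores the exact value 1. The condition
  speaks of vectors of K and not of an algebra, so it also carries states from the generated algebra
  to B(K), where otherwise an extension theorem for positive functionals would be called for. Two
  further points need work. The norm of sum_j alpha_j^* alpha_j is taken on C^n while the tensors
  act on K^n, so an inequality for scalar vectors must be transferred to vectors with entries in K;
  expansion in an orthogonal family does this. And the generated algebra may have no identity: a
  state of B(K) could lose norm on restriction, and the usual square root of 1 - T^* T is not at
  hand when a representation is shown to be contractive. The former is repaired by an element C_j^*
  C_j of norm at most 1 at which the state is 1, the latter by working with 1 minus that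
  root.\<close>

lemma cinner_add_right: "cinner x (y + z) = cinner x y + cinner x z"
  by (metis cinner_add_left cinner_commute complex_cnj_add)

lemma cinner_scaleR_left: "cinner (r *\<^sub>R x) y = complex_of_real r * cinner x y"
  by (metis cinner_scaleC_left scaleC_of_real)

lemma cinner_scaleR_right: "cinner x (r *\<^sub>R y) = complex_of_real r * cinner x y"
  by (metis cinner_scaleC_right complex_cnj_complex_of_real scaleC_of_real)

lemma cinner_self: "cinner x x = complex_of_real ((norm x)\<^sup>2)"
proof -
  have "Im (cinner x x) = 0"
    using arg_cong[OF cinner_commute[of x x], of Im] by simp
  moreover have "Re (cinner x x) = (norm x)\<^sup>2"
    by (simp add: norm_eq_sqrt_cinner[of x] cinner_ge_zero)
  ultimately show ?thesis by (simp add: complex_eq_iff)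
qed

lemma cinner_zero_left [simp]: "cinner 0 y = 0"
  using cinner_scaleR_left[of 0 0 y] by simp

lemma cinner_zero_right [simp]: "cinner y 0 = 0"
  using cinner_scaleR_right[of y 0 0] by simp

lemma cinner_minus_left: "cinner (- x) y = - cinner x y"
  using cinner_scaleR_left[of "-1" x y] by simp

lemma cinner_minus_right: "cinner x (- y) = - cinner x y"
  using cinner_scaleR_right[of x "-1" y] by simp

lemma cinner_diff_left: "cinner (x - y) z = cinner x z - cinner y z"
  using cinner_add_left[of x "- y" z] by (simp add: cinner_minus_left)

lemma cinner_diff_right: "cinner x (y - z) = cinner x y - cinner x z"
  using cinner_add_right[of x y "- z"] by (simp add: cinner_minus_right)

lemma cinner_sum_left: "cinner (\<Sum>i\<in>I. f i) y = (\<Sum>i\<in>I. cinner (f i) y)"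
  by (induction I rule: infinite_finite_induct) (auto simp: cinner_add_left)

lemma cinner_sum_right: "cinner x (\<Sum>i\<in>I. f i) = (\<Sum>i\<in>I. cinner x (f i))"
  by (induction I rule: infinite_finite_induct) (auto simp: cinner_add_right)

lemma Re_cinner_commute: "Re (cinner y x) = Re (cinner x y)"
  by (metis cinner_commute cnj.simps(1))

lemma norm_add_sq: "(norm (x + y))\<^sup>2 = (norm x)\<^sup>2 + (norm (y::'a::chilbert_space))\<^sup>2 + 2 * Re (cinner x y)"
proof -
  have "(norm (x + y))\<^sup>2 = Re (cinner (x + y) (x + y))"
    by (simp add: cinner_self del: of_real_power)
  also have "\<dots> = Re (cinner x x) + Re (cinner y y) + 2 * Re (cinner x y)"
    by (simp add: cinner_add_left cinner_add_right Re_cinner_commute[of y x])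
  finally show ?thesis by (simp add: cinner_self del: of_real_power)
qed

lemma norm_diff_sq: "(norm (x - y))\<^sup>2 = (norm x)\<^sup>2 + (norm (y::'a::chilbert_space))\<^sup>2 - 2 * Re (cinner x y)"
  using norm_add_sq[of x "- y"] by (simp add: cinner_minus_right)

lemma scaleC_zero_right [simp]: "c *\<^sub>C (0::'a::chilbert_space) = 0"
  by (metis mult_zero_right norm_eq_zero norm_scaleC)

lemma scaleC_zero_left [simp]: "0 *\<^sub>C (x::'a::chilbert_space) = 0"
  by (metis mult_zero_left norm_eq_zero norm_scaleC norm_zero)

lemma scaleC_one [simp]: "1 *\<^sub>C (x::'a::chilbert_space) = x"
  using scaleC_of_real[of 1 x] by simp

lemma scaleC_sum_right: "c *\<^sub>C (\<Sum>i\<in>I. f i) = (\<Sum>i\<in>I. c *\<^sub>C (f i :: 'a::chilbert_space))"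
  by (induction I rule: infinite_finite_induct) (auto simp: scaleC_add_right)

lemma scaleC_sum_left: "(\<Sum>i\<in>I. c i) *\<^sub>C (x :: 'a::chilbert_space) = (\<Sum>i\<in>I. c i *\<^sub>C x)"
  by (induction I rule: infinite_finite_induct) (auto simp: scaleC_add_left)

lemma Re_cinner_le: "Re (cinner x y) \<le> norm x * norm y"
proof (cases "x = 0 \<or> y = 0")
  case False
  then have pos: "norm x * norm y > 0" by simp
  have "0 \<le> (norm (norm y *\<^sub>R x - norm x *\<^sub>R y))\<^sup>2" by simp
  also have "\<dots> = 2 * (norm x * norm y) * (norm x * norm y - Re (cinner x y))"
    by (subst norm_diff_sq) (simp add: cinner_scaleR_left cinner_scaleR_right power_mult_distrib algebra_simps power2_eq_square)
  finally have "0 \<le> norm x * norm y - Re (cinner x y)"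
    using pos by (simp add: zero_le_mult_iff)
  then show ?thesis by simp
qed auto

lemma cmod_cinner_le: "cmod (cinner x y) \<le> norm x * norm y"
proof (cases "cinner x y = 0")
  case False
  define u where "u = cnj (cinner x y) / cmod (cinner x y)"
  have u: "cmod u = 1" using False by (simp add: u_def norm_divide)
  have "cinner (u *\<^sub>C x) y = complex_of_real (cmod (cinner x y))"
    using False
    by (simp add: cinner_scaleC_left u_def mult.commute[of "cnj _"] field_simps power2_eq_square
        flip: complex_norm_square)
  then have "cmod (cinner x y) = Re (cinner (u *\<^sub>C x) y)" by simp
  also have "\<dots> \<le> norm x * norm y"
    using Re_cinner_le[of "u *\<^sub>C x" y] by (simp add: norm_scaleC u)
  finally show ?thesis .
qed simp

lemma bounded_bilinear_cinner:
  "bounded_bilinear (cinner :: 'a \<Rightarrow> 'a::chilbert_space \<Rightarrow> complex)"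
proof (rule bounded_bilinear.intro)
  show "\<exists>K. \<forall>x y::'a. cmod (cinner x y) \<le> norm x * norm y * K"
    by (intro exI[of _ 1]) (simp add: cmod_cinner_le)
qed (auto simp: cinner_add_left cinner_add_right cinner_scaleR_left cinner_scaleR_right scaleR_conv_of_real)

lemmas tendsto_cinner [tendsto_intros] = bounded_bilinear.tendsto[OF bounded_bilinear_cinner]

lemma cinner_eqI: "(\<And>x. cinner x a = cinner x b) \<Longrightarrow> a = b"
proof -
  assume "\<And>x. cinner x a = cinner x b"
  then have "cinner (a - b) (a - b) = 0" by (simp add: cinner_diff_right)
  then show "a = b" by (simp add: cinner_self)
qed


section \<open>The Riesz representation theorem and adjoints\<close>

text \<open>The representing vector minimizes \<open>\<parallel>z\<parallel>\<^sup>2 - 2 g z\<close>; minimizing sequences are Cauchy by the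
  parallelogram law.\<close>

lemma riesz_real:
  fixes g :: "'a::chilbert_space \<Rightarrow> real"
  assumes "bounded_linear g"
  obtains z where "\<And>h. Re (cinner h z) = g h"
proof -
  interpret g: bounded_linear g by fact
  define q where "q z = (norm z)\<^sup>2 - 2 * g z" for z
  obtain K where K: "\<And>x. norm (g x) \<le> norm x * K" using g.bounded by blast
  have lower: "- (K\<^sup>2) \<le> q z" for z
  proof -
    have "g z \<le> norm z * K" using K[of z] by simp
    moreover have "0 \<le> (norm z - K)\<^sup>2" by simp
    ultimately show ?thesis by (simp add: q_def power2_eq_square algebra_simps)
  qed
  then have bdd: "bdd_below (range q)" by (auto simp: bdd_below_def)
  define m where "m = Inf (range q)"
  have m_le: "m \<le> q z" for z unfolding m_def by (rule cINF_lower[OF bdd]) simp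
  have "\<exists>z. q z < m + 1 / Suc n" for n
    using cINF_less_iff[OF _ bdd, of "m + 1 / Suc n"] by (simp add: m_def)
  then obtain z where z: "\<And>n. q (z n) < m + 1 / Suc n" by metis
  have par: "(norm (a - b))\<^sup>2 \<le> 2 * (q a - m) + 2 * (q b - m)" for a b
  proof -
    have eq: "4 * q ((1/2) *\<^sub>R (a + b)) = (norm (a + b))\<^sup>2 - 4 * g a - 4 * g b"
      unfolding q_def by (simp add: g.scaleR g.add power_divide add_divide_distrib del: scaleR_add_right)
    show ?thesis
      using m_le[of "(1/2) *\<^sub>R (a + b)"] eq norm_add_sq[of a b] norm_diff_sq[of a b]
      by (simp add: q_def)
  qed
  have "Cauchy z"
  proof (rule metric_CauchyI)
    fix e :: real assume e: "e > 0"
    then obtain N where N: "1 / Suc N < e\<^sup>2 / 4"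
      using nat_approx_posE[of "e\<^sup>2 / 4"] by (auto simp: power2_eq_square)
    have q: "q (z n) - m < e\<^sup>2 / 4" if "n \<ge> N" for n
    proof -
      have "1 / Suc n \<le> 1 / Suc N" using that by (simp add: frac_le)
      then show ?thesis using z[of n] N by linarith
    qed
    show "\<exists>N. \<forall>i\<ge>N. \<forall>j\<ge>N. dist (z i) (z j) < e"
    proof (intro exI allI impI)
      fix i j assume ij: "i \<ge> N" "j \<ge> N"
      have "(norm (z i - z j))\<^sup>2 < e\<^sup>2"
        using par[of "z i" "z j"] q[OF ij(1)] q[OF ij(2)] by (simp add: field_simps)
      then show "dist (z i) (z j) < e" using e by (simp add: dist_norm power2_less_imp_less)
    qed
  qed
  then obtain w where w: "z \<longlonglongrightarrow> w" using Cauchy_convergent convergentD by blast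
  have "(\<lambda>n. q (z n)) \<longlonglongrightarrow> q w"
    unfolding q_def by (intro tendsto_intros w g.tendsto)
  moreover have "(\<lambda>n. m + 1 / Suc n) \<longlonglongrightarrow> m + 0"
    by (intro tendsto_intros LIMSEQ_inverse_real_of_nat[unfolded inverse_eq_divide])
  ultimately have "q w \<le> m + 0"
    by (rule LIMSEQ_le) (use z less_imp_le in blast)
  then have min: "q w \<le> q y" for y using m_le[of y] by simp
  have "Re (cinner h w) = g h" for h
  proof (rule ccontr)
    \<comment> \<open>\<open>d\<close> is half the derivative at t = 0 of
      \<open>q (w + t *\<^sub>R h)\<close>, so it must vanish at the minimum.\<close>
    define d where "d = Re (cinner w h) - g h"
    assume "Re (cinner h w) \<noteq> g h"
    then have d: "d \<noteq> 0" by (simp add: d_def Re_cinner_commute)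
    have step: "0 \<le> t\<^sup>2 * (norm h)\<^sup>2 + 2 * t * d" for t
      using min[of "w + t *\<^sub>R h"]
      by (simp add: q_def norm_add_sq g.add g.scaleR d_def cinner_scaleR_right power_mult_distrib algebra_simps)
    \<comment> \<open>The trial step t = - d / s lowers \<open>q\<close> by at least d^2 / s. Adding
      1 to |h|^2 keeps \<open>s\<close> positive without a case distinction on
      \<open>h\<close>.\<close>
    define s where "s = 1 + (norm h)\<^sup>2"
    have s: "s > 0" by (simp add: s_def add_pos_nonneg)
    have "(d\<^sup>2 / s\<^sup>2) * (norm h)\<^sup>2 \<le> (d\<^sup>2 / s\<^sup>2) * s"
      by (intro mult_left_mono) (auto simp: s_def)
    also have "\<dots> = d\<^sup>2 / s" using s by (simp add: power2_eq_square)
    finally have "0 \<le> - (d\<^sup>2 / s)"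
      using step[of "- d / s"] by (simp add: power_divide power2_eq_square)
    then show False using d s by (simp add: divide_le_0_iff field_simps)
  qed
  then show ?thesis using that by blast
qed

lemma adj_exists:
  fixes T :: "'a::chilbert_space \<Rightarrow>\<^sub>L 'a"
  assumes T: "T \<in> bounded_ops"
  obtains S where "S \<in> bounded_ops" "\<And>x y. cinner (T x) y = cinner x (S y)"
proof -
  have "\<exists>z. \<forall>x. cinner (T x) y = cinner x z" for y
  proof -
    have "bounded_linear (\<lambda>x. Re (cinner (T x) y))"
      using bounded_linear_compose[OF bounded_linear_Re
          bounded_linear_compose[OF bounded_bilinear.bounded_linear_left[OF bounded_bilinear_cinner]
            blinfun.bounded_linear_right[of T]]]
      by simp
    then obtain z where z: "\<And>h. Re (cinner h z) = Re (cinner (T h) y)"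
      using riesz_real by blast
    \<comment> \<open>The Riesz vector matches real parts only; putting i h for h, with which the
      complex-linear T is compatible, turns these into imaginary parts.\<close>
    have "Im (cinner h z) = Im (cinner (T h) y)" for h
      using z[of "\<i> *\<^sub>C h"] T by (simp add: bounded_ops_def cinner_scaleC_left)
    with z have "cinner (T x) y = cinner x z" for x by (simp add: complex_eq_iff)
    then show ?thesis by blast
  qed
  then obtain s where s: "\<And>x y. cinner (T x) y = cinner x (s y)" by metis
  have "bounded_linear s"
  proof (rule bounded_linear_intro)
    show "s (x + y) = s x + s y" for x y
      by (rule cinner_eqI) (metis s cinner_add_right)
    show "s (r *\<^sub>R x) = r *\<^sub>R s x" for r x
      by (rule cinner_eqI) (metis s cinner_scaleR_right)
    show "norm (s y) \<le> norm y * norm T" for y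
    proof (cases "s y = 0")
      case False
      have "(norm (s y))\<^sup>2 = cmod (cinner (T (s y)) y)" by (simp add: s cinner_self norm_power)
      also have "\<dots> \<le> norm T * norm (s y) * norm y"
        by (meson cmod_cinner_le mult_right_mono norm_blinfun norm_ge_zero order_trans)
      finally show ?thesis using False by (simp add: power2_eq_square mult.commute mult.left_commute)
    qed simp
  qed
  then have app: "blinfun_apply (Blinfun s) = s" by (rule bounded_linear_Blinfun_apply)
  have "s (c *\<^sub>C x) = c *\<^sub>C s x" for c x
    by (rule cinner_eqI) (metis s cinner_scaleC_right)
  then have "Blinfun s \<in> bounded_ops" by (simp add: bounded_ops_def app)
  with that s app show ?thesis by metis
qed

lemma adj_eqI:
  fixes S T :: "'a::chilbert_space \<Rightarrow>\<^sub>L 'a"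
  assumes "S \<in> bounded_ops" "\<And>x y. cinner (T x) y = cinner x (S y)"
  shows "adj T = S"
  unfolding adj_def
proof (rule the_equality)
  show "S' = S" if "S' \<in> bounded_ops \<and> (\<forall>x y. cinner (T x) y = cinner x (S' y))" for S'
    using that assms(2) by (metis blinfun_eqI cinner_eqI)
qed (use assms in blast)

lemma
  fixes T :: "'a::chilbert_space \<Rightarrow>\<^sub>L 'a"
  assumes "T \<in> bounded_ops"
  shows adj_bounded_ops: "adj T \<in> bounded_ops"
    and cinner_adj: "cinner (T x) y = cinner x (adj T y)"
    and cinner_adj': "cinner (adj T x) y = cinner x (T y)"
proof -
  obtain S where "S \<in> bounded_ops" "\<And>x y. cinner (T x) y = cinner x (S y)"
    using adj_exists[OF assms] by blast
  then show "adj T \<in> bounded_ops" and *: "cinner (T x) y = cinner x (adj T y)" for x y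
    using adj_eqI by metis+
  show "cinner (adj T x) y = cinner x (T y)"
    by (metis * cinner_commute)
qed

lemma norm_adj_le:
  assumes "T \<in> bounded_ops"
  shows "norm (adj T) \<le> norm T"
proof (rule norm_blinfun_bound)
  show "norm (adj T y) \<le> norm T * norm y" for y
  proof (cases "adj T y = 0")
    case False
    have "(norm (adj T y))\<^sup>2 = cmod (cinner (T (adj T y)) y)"
      by (simp add: cinner_adj[OF assms] cinner_self norm_power)
    also have "\<dots> \<le> norm T * norm (adj T y) * norm y"
      by (meson cmod_cinner_le mult_right_mono norm_blinfun norm_ge_zero order_trans)
    finally show ?thesis using False by (simp add: power2_eq_square mult.commute mult.left_commute)
  qed simp
qed simp

lemma norm_adj_compose_le:
  assumes "T \<in> bounded_ops"
  shows "norm (adj T o\<^sub>L T) \<le> (norm T)\<^sup>2"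
  using norm_blinfun_compose[of "adj T" T] mult_right_mono[OF norm_adj_le[OF assms], of "norm T"]
  by (simp add: power2_eq_square)

lemma cinner_adj_compose:
  assumes "T \<in> bounded_ops"
  shows "cinner ((adj T o\<^sub>L T) x) x = complex_of_real ((norm (T x))\<^sup>2)"
  by (simp add: cinner_adj'[OF assms] cinner_self)


section \<open>Operator algebras and representations\<close>

lemma bounded_linear_scaleC_right:
  "bounded_linear (\<lambda>x. c *\<^sub>C (x::'a::chilbert_space))"
proof (rule bounded_linear_intro)
  show "c *\<^sub>C (r *\<^sub>R x) = r *\<^sub>R (c *\<^sub>C x)" for r and x :: 'a
    by (simp add: scaleC_scaleC mult.commute flip: scaleC_of_real)
  show "norm (c *\<^sub>C x) \<le> norm x * cmod c" for x :: 'a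
    by (simp add: norm_scaleC)
qed (rule scaleC_add_right)

lemma scaleC_op_of_real: "scaleC_op (complex_of_real r) T = r *\<^sub>R T"
  by (rule blinfun_eqI) (simp add: scaleC_op.rep_eq scaleC_of_real blinfun.scaleR_left)

lemma closed_bounded_ops: "closed (bounded_ops :: ('a::chilbert_space \<Rightarrow>\<^sub>L 'a) set)"
  unfolding bounded_ops_def
  by (intro closed_Collect_all closed_Collect_eq bounded_linear.continuous_on[OF bounded_linear_scaleC_right]
      continuous_intros)

lemma cstar_subalgebra_bounded_ops: "cstar_subalgebra bounded_ops"
  unfolding cstar_subalgebra_def
proof (intro conjI ballI allI)
  show "scaleC_op c T \<in> bounded_ops" if "T \<in> bounded_ops" for c and T :: "'a \<Rightarrow>\<^sub>L 'a"
    using that by (simp add: bounded_ops_def scaleC_op.rep_eq scaleC_scaleC mult.commute)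
qed (auto simp: closed_bounded_ops adj_bounded_ops,
     auto simp: bounded_ops_def blinfun.add_left scaleC_add_right)

text \<open>B(K) itself is among the algebras that are intersected, so the intersection stays inside
  B(K); the closure properties pass to intersections.\<close>

lemma
  fixes X :: "('a::chilbert_space \<Rightarrow>\<^sub>L 'a) set"
  assumes "X \<subseteq> bounded_ops"
  shows cstar_generated_subset_bounded_ops: "cstar_generated X \<subseteq> bounded_ops"
    and cstar_subalgebra_generated: "cstar_subalgebra (cstar_generated X)"
    and cstar_generated_superset: "X \<subseteq> cstar_generated X"
proof -
  show sub: "cstar_generated X \<subseteq> bounded_ops"
    unfolding cstar_generated_def using assms cstar_subalgebra_bounded_ops by blast
  show "X \<subseteq> cstar_generated X"
    unfolding cstar_generated_def by blast
  have "closed (cstar_generated X)"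
    unfolding cstar_generated_def by (rule closed_Inter) (auto simp: cstar_subalgebra_def)
  then show "cstar_subalgebra (cstar_generated X)"
    using sub unfolding cstar_subalgebra_def
    by (auto simp: cstar_generated_def cstar_subalgebra_def)
qed

lemma cstar_subalgebraD:
  assumes "cstar_subalgebra A"
  shows "A \<subseteq> bounded_ops" "0 \<in> A" "closed A"
    "S \<in> A \<Longrightarrow> T \<in> A \<Longrightarrow> S + T \<in> A"
    "S \<in> A \<Longrightarrow> T \<in> A \<Longrightarrow> S o\<^sub>L T \<in> A"
    "T \<in> A \<Longrightarrow> scaleC_op c T \<in> A"
    "T \<in> A \<Longrightarrow> r *\<^sub>R T \<in> A"
    "T \<in> A \<Longrightarrow> adj T \<in> A"
  using assms by (auto simp: cstar_subalgebra_def simp flip: scaleC_op_of_real)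

section \<open>Representations of operator algebras are contractive\<close>

text \<open>\<open>Z = 1 - sqrt (1 - P)\<close>, obtained inside the possibly nonunital algebra as the fixed point of the
  contraction \<open>z \<mapsto> (P + z\<^sup>2) / 2\<close> on a ball.\<close>

lemma cstar_quadratic_root:
  fixes A :: "('a::chilbert_space \<Rightarrow>\<^sub>L 'a) set"
  assumes A: "cstar_subalgebra A" and P: "P \<in> A" "norm P < 1"
    and sa: "\<And>x y. cinner (P x) y = cinner x (P y)"
  obtains Z where "Z \<in> A" "adj Z = Z" "P + (Z o\<^sub>L Z) = Z + Z"
proof -
  \<comment> \<open>\<open>r\<close> is the smaller root of 2 r = |P| + r^2. This equation makes the
    ball of radius \<open>r\<close> invariant under \<open>f\<close>, and \<open>r\<close> < 1
    serves as the contraction constant.\<close>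
  define r where "r = 1 - sqrt (1 - norm P)"
  have r: "0 \<le> r" "r < 1" "norm P + r * r = 2 * r"
    using P by (auto simp: r_def algebra_simps)
  \<comment> \<open>Self-adjointness is expressed through the inner product instead of
    \<open>adj\<close>, since in this form it is visibly a closed condition.\<close>
  define S where "S = {z \<in> A. (\<forall>x y. cinner (z x) y = cinner x (z y)) \<and> norm z \<le> r}"
  define f where "f z = (1/2) *\<^sub>R (P + (z o\<^sub>L z))" for z
  have "closed {z. (\<forall>x y. cinner (blinfun_apply z x) y = cinner x (z y)) \<and> norm z \<le> r}"
    by (intro closed_Collect_conj closed_Collect_all closed_Collect_eq closed_Collect_le
        bounded_bilinear.continuous_on[OF bounded_bilinear_cinner] continuous_intros)
  then have "closed S"
    unfolding S_def using cstar_subalgebraD(3)[OF A] closed_Int[of A] by (simp add: Collect_conj_eq)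
  then have "complete S" by (simp add: complete_eq_closed)
  moreover have "S \<noteq> {}"
    using cstar_subalgebraD(2)[OF A] r by (auto simp: S_def intro!: exI[of _ 0])
  moreover have "f ` S \<subseteq> S"
  proof
    fix w assume "w \<in> f ` S"
    then obtain z where z: "z \<in> S" and w: "w = f z" by blast
    have "norm (z o\<^sub>L z) \<le> r * r"
      using z norm_blinfun_compose[of z z] mult_mono[of "norm z" r "norm z" r] r by (auto simp: S_def)
    then have "norm (P + (z o\<^sub>L z)) \<le> 2 * r"
      using norm_triangle_ineq[of P "z o\<^sub>L z"] r by linarith
    then show "w \<in> S"
      using z by (auto simp: S_def w f_def blinfun.scaleR_left blinfun.add_left cinner_scaleR_left
          cinner_scaleR_right cinner_add_left cinner_add_right sa P cstar_subalgebraD[OF A])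
  qed
  moreover have "\<forall>x\<in>S. \<forall>y\<in>S. dist (f x) (f y) \<le> r * dist x y"
  proof (intro ballI)
    fix x y assume x: "x \<in> S" and y: "y \<in> S"
    \<comment> \<open>x^2 - y^2 = x (x - y) + (x - y) y, a factorization valid for noncommuting x
      and y.\<close>
    have "f x - f y = (1/2) *\<^sub>R ((x o\<^sub>L (x - y)) + ((x - y) o\<^sub>L y))"
      by (rule blinfun_eqI)
        (simp add: f_def blinfun.diff_left blinfun.diff_right blinfun.add_left blinfun.scaleR_left
          scaleR_right_diff_distrib scaleR_right_distrib)
    then have "norm (f x - f y) \<le> (1/2) * (norm (x o\<^sub>L (x - y)) + norm ((x - y) o\<^sub>L y))"
      by (simp add: norm_triangle_ineq)
    also have "\<dots> \<le> (1/2) * (norm x * norm (x - y) + norm (x - y) * norm y)"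
      using norm_blinfun_compose[of x "x - y"] norm_blinfun_compose[of "x - y" y] by simp
    also have "\<dots> \<le> (1/2) * (r * norm (x - y) + norm (x - y) * r)"
      using x y r by (intro mult_left_mono add_mono mult_mono) (auto simp: S_def)
    finally show "dist (f x) (f y) \<le> r * dist x y" by (simp add: dist_norm mult.commute)
  qed
  ultimately obtain Z where Z: "Z \<in> S" "f Z = Z"
    using Banach_fix[of S r f] r by blast
  have "adj Z = Z"
    using Z cstar_subalgebraD(1)[OF A] by (intro adj_eqI) (auto simp: S_def)
  moreover have "P + (Z o\<^sub>L Z) = 2 *\<^sub>R f Z" by (simp add: f_def)
  ultimately show ?thesis
    using that[of Z] Z by (simp add: S_def scaleR_2)
qed

text \<open>With 1 - r^2 T^* T = (1 - Z)^2 for a self-adjoint Z in A one gets |v|^2 - r^2 |pi(T)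
  v|^2 = |pi(Z) v - v|^2 >= 0. As A may lack an identity, the first equation is used in the form P +
  Z^2 = 2 Z, to which \<open>\<pi>\<close> can be applied.\<close>

lemma representation_contractive:
  fixes \<pi> :: "('a::chilbert_space \<Rightarrow>\<^sub>L 'a) \<Rightarrow> ('h::chilbert_space \<Rightarrow>\<^sub>L 'h)"
  assumes A: "cstar_subalgebra A" and \<pi>: "representation A \<pi>" and T: "T \<in> A" "norm T \<le> 1"
  shows "norm (\<pi> T) \<le> 1"
proof (rule norm_blinfun_bound)
  fix v
  have Tb: "T \<in> bounded_ops" using T cstar_subalgebraD(1)[OF A] by blast
  \<comment> \<open>Keeping \<open>r\<close> strictly below 1 ensures |P| < 1, as the fixed point
    construction of Z requires; the factor disappears in the limit r -> 1.\<close>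
  have "r * norm (\<pi> T v) \<le> norm v" if r: "0 < r" "r < 1" for r
  proof -
    define P where "P = (r\<^sup>2) *\<^sub>R (adj T o\<^sub>L T)"
    have PA: "P \<in> A" by (simp add: P_def cstar_subalgebraD[OF A] T)
    have "norm (adj T o\<^sub>L T) \<le> 1"
      using norm_adj_compose_le[OF Tb] T by (meson norm_ge_zero order_trans power_le_one)
    moreover have "r\<^sup>2 < 1" using r by (simp add: power_less_one_iff)
    ultimately have "norm P < 1"
      using mult_left_mono[of "norm (adj T o\<^sub>L T)" 1 "r\<^sup>2"] by (simp add: P_def)
    moreover have "cinner (P x) y = cinner x (P y)" for x y
      by (simp add: P_def blinfun.scaleR_left cinner_scaleR_left cinner_scaleR_right
          cinner_adj[OF Tb] cinner_adj'[OF Tb])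
    ultimately obtain Z where Z: "Z \<in> A" "adj Z = Z" "P + (Z o\<^sub>L Z) = Z + Z"
      using cstar_quadratic_root[OF A PA] by metis
    have hom: "\<pi> (S + S') = \<pi> S + \<pi> S'" "\<pi> (S o\<^sub>L S') = \<pi> S o\<^sub>L \<pi> S'" "\<pi> S \<in> bounded_ops"
      "\<pi> (scaleC_op c S) = scaleC_op c (\<pi> S)" "\<pi> (adj S) = adj (\<pi> S)"
      if "S \<in> A" "S' \<in> A" for S S' c
      using \<pi> that by (auto simp: representation_def)
    have "\<pi> P + (\<pi> Z o\<^sub>L \<pi> Z) = \<pi> Z + \<pi> Z"
      using arg_cong[OF Z(3), of \<pi>] Z(1) PA by (simp add: hom cstar_subalgebraD[OF A])
    moreover have "\<pi> P = (r\<^sup>2) *\<^sub>R (adj (\<pi> T) o\<^sub>L \<pi> T)"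
      using T by (simp add: P_def hom cstar_subalgebraD[OF A] flip: scaleC_op_of_real del: of_real_power)
    ultimately have "(r\<^sup>2) *\<^sub>R (adj (\<pi> T) (\<pi> T v)) + \<pi> Z (\<pi> Z v) = \<pi> Z v + \<pi> Z v"
      by (metis (no_types, lifting) blinfun.add_left blinfun.scaleR_left blinfun_apply_blinfun_compose)
    from arg_cong[OF this, of "\<lambda>w. Re (cinner w v)"]
    have "r\<^sup>2 * Re (cinner (adj (\<pi> T) (\<pi> T v)) v) + Re (cinner (\<pi> Z (\<pi> Z v)) v) = 2 * Re (cinner (\<pi> Z v) v)"
      by (simp add: cinner_add_left cinner_scaleR_left del: of_real_power)
    moreover have "cinner (\<pi> Z (\<pi> Z v)) v = cinner (\<pi> Z v) (\<pi> Z v)"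
      using cinner_adj[of "\<pi> Z" "\<pi> Z v" v] hom(3)[OF Z(1) Z(1)] hom(5)[OF Z(1) Z(1)] Z(2) by simp
    ultimately have "r\<^sup>2 * (norm (\<pi> T v))\<^sup>2 + (norm (\<pi> Z v))\<^sup>2 = 2 * Re (cinner (\<pi> Z v) v)"
      using T by (simp add: cinner_adj' hom cinner_self del: of_real_power)
    moreover have "0 \<le> (norm (\<pi> Z v - v))\<^sup>2" by simp
    ultimately have "(r * norm (\<pi> T v))\<^sup>2 \<le> (norm v)\<^sup>2"
      by (simp add: norm_diff_sq power_mult_distrib)
    then show ?thesis by (rule power2_le_imp_le) simp
  qed
  then have "\<forall>\<^sub>F r in at_left 1. r * norm (\<pi> T v) \<le> norm v"
    by (auto simp: eventually_at_left_field intro!: exI[of _ 0])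
  moreover have "((\<lambda>r. r * norm (\<pi> T v)) \<longlongrightarrow> 1 * norm (\<pi> T v)) (at_left 1)"
    by (intro tendsto_intros)
  ultimately show "norm (\<pi> T v) \<le> 1 * norm v"
    by (auto intro: tendsto_upperbound)
qed simp


section \<open>States and jointly norming vectors\<close>

text \<open>The squares make this a statement on vector states: |C_j x|^2 is the value at C_j^* C_j
  of the functional given by x. Finitely many j at a time suffice for a limit of vector states and
  keep the sums of the C_j^* C_j finite.\<close>

definition jointly_norming :: "'j set \<Rightarrow> ('j \<Rightarrow> 'a::real_normed_vector \<Rightarrow>\<^sub>L 'a) \<Rightarrow> bool" where
  "jointly_norming J C \<longleftrightarrow>
     (\<forall>F e. finite F \<and> F \<subseteq> J \<and> e > 0 \<longrightarrow> (\<exists>x. norm x = 1 \<and> (\<forall>j\<in>F. 1 - e < (norm (C j x))\<^sup>2)))"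

text \<open>None of the card F terms exceeds 1, so a sum within e of card F puts each single term
  within e of 1. For empty F any nonzero vector serves after normalization.\<close>

lemma jointly_normingI:
  fixes C :: "'j \<Rightarrow> 'a::real_normed_vector \<Rightarrow>\<^sub>L 'a"
  assumes ex: "\<exists>x::'a. x \<noteq> 0" and C: "\<And>j. j \<in> J \<Longrightarrow> norm (C j) \<le> 1"
    and sum: "\<And>F e. finite F \<Longrightarrow> F \<subseteq> J \<Longrightarrow> F \<noteq> {} \<Longrightarrow> e > 0 \<Longrightarrow>
      \<exists>x. norm x \<le> 1 \<and> real (card F) - e < (\<Sum>j\<in>F. (norm (C j x))\<^sup>2)"
  shows "jointly_norming J C"
  unfolding jointly_norming_def
proof (intro allI impI)
  fix F and e :: real
  assume F: "finite F \<and> F \<subseteq> J \<and> e > 0"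
  show "\<exists>x. norm x = 1 \<and> (\<forall>j\<in>F. 1 - e < (norm (C j x))\<^sup>2)"
  proof (cases "F = {}")
    case True
    from ex obtain x :: 'a where "x \<noteq> 0" by blast
    then show ?thesis using True by (intro exI[of _ "x /\<^sub>R norm x"]) simp
  next
    case False
    \<comment> \<open>Capping at 1 keeps 1 - d nonnegative, so that |C_i x|^2 > 1 - d excludes x = 0
      and the vector can be normalized.\<close>
    define d where "d = min e 1"
    have d: "0 < d" "d \<le> 1" "d \<le> e" using F by (auto simp: d_def)
    obtain x where x: "norm x \<le> 1" "real (card F) - d < (\<Sum>j\<in>F. (norm (C j x))\<^sup>2)"
      using sum[of F d] F False d by blast
    have each: "1 - d < (norm (C j x))\<^sup>2" if j: "j \<in> F" for j
    proof -
      have "(norm (C i x))\<^sup>2 \<le> 1" if "i \<in> F" for i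
      proof -
        have "norm (C i) \<le> 1" using C[of i] that F by blast
        then have "norm (C i x) \<le> 1 * 1"
          using norm_blinfun[of "C i" x] mult_mono[of "norm (C i)" 1 "norm x" 1] x by simp
        then show ?thesis by (simp add: power_le_one)
      qed
      then have "(\<Sum>i\<in>F - {j}. (norm (C i x))\<^sup>2) \<le> real (card (F - {j}))"
        using sum_mono[of "F - {j}" "\<lambda>i. (norm (C i x))\<^sup>2" "\<lambda>_. 1"] by simp
      moreover have "real (card F) = 1 + real (card (F - {j}))"
        using F j card.remove[of F j] by simp
      moreover have "(\<Sum>i\<in>F. (norm (C i x))\<^sup>2) = (norm (C j x))\<^sup>2 + (\<Sum>i\<in>F - {j}. (norm (C i x))\<^sup>2)"
        using F j by (intro sum.remove) auto
      ultimately show ?thesis using x(2) by linarith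
    qed
    from False obtain i where "i \<in> F" by blast
    then have "x \<noteq> 0" using each[of i] d by auto
    \<comment> \<open>As 0 < |x| <= 1, normalizing can only enlarge |C_j x|.\<close>
    define y where "y = x /\<^sub>R norm x"
    have "norm (C j x) \<le> norm (C j y)" for j
      using x \<open>x \<noteq> 0\<close> mult_right_mono[of "norm x" 1 "norm (C j x)"]
      by (simp add: y_def blinfun.scaleR_right field_simps)
    then have "(norm (C j x))\<^sup>2 \<le> (norm (C j y))\<^sup>2" for j by (simp add: power_mono)
    then have "1 - e < (norm (C j y))\<^sup>2" if "j \<in> F" for j
      using each[OF that] d by (smt (verit))
    moreover have "norm y = 1" using \<open>x \<noteq> 0\<close> by (simp add: y_def)
    ultimately show ?thesis by blast
  qed
qed

section \<open>From states to norming vectors\<close>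

lemma state_bound:
  assumes A: "cstar_subalgebra A" and \<omega>: "is_state A \<omega>" and T: "T \<in> A"
  shows "cmod (\<omega> T) \<le> norm T"
proof (cases "T = 0")
  case True
  have "\<omega> (scaleC_op 0 T) = 0 * \<omega> T" using \<omega> T unfolding is_state_def by blast
  then show ?thesis using True scaleC_op_of_real[of 0 T] by simp
next
  case False
  let ?S = "scaleC_op (complex_of_real (inverse (norm T))) T"
  have "?S \<in> A" using T by (rule cstar_subalgebraD(6)[OF A])
  moreover have "norm ?S \<le> 1"
    unfolding scaleC_op_of_real using False by simp
  ultimately have "cmod (\<omega> ?S) \<le> 1"
    using \<omega> cSUP_upper[of ?S "{T \<in> A. norm T \<le> 1}" "\<lambda>T. cmod (\<omega> T)"] unfolding is_state_def by simp
  moreover have "\<omega> ?S = complex_of_real (inverse (norm T)) * \<omega> T"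
    using \<omega> T unfolding is_state_def by blast
  ultimately have "inverse (norm T) * cmod (\<omega> T) \<le> 1"
    by (simp add: norm_mult norm_inverse)
  then show ?thesis using False by (simp add: field_simps)
qed

text \<open>The premise \<open>big\<close> says that \<open>b\<close> is at most the squared norm of
  the column x |-> (C_j x)_j. The supremum defining that norm need not be attained, hence the loss
  of \<open>e\<close>. Without such a vector, b - e would itself be an admissible M, by
  homogeneity.\<close>

lemma norming_sum_vector:
  fixes C :: "'j \<Rightarrow> 'a::real_normed_vector \<Rightarrow>\<^sub>L 'a"
  assumes "e > 0"
    and big: "\<And>M. 0 \<le> M \<Longrightarrow> (\<And>x. (\<Sum>j\<in>F. (norm (C j x))\<^sup>2) \<le> M * (norm x)\<^sup>2) \<Longrightarrow> b \<le> M"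
  shows "\<exists>x. norm x \<le> 1 \<and> b - e < (\<Sum>j\<in>F. (norm (C j x))\<^sup>2)"
proof (rule ccontr)
  assume neg: "\<not> ?thesis"
  define M where "M = b - e"
  have M: "(\<Sum>j\<in>F. (norm (C j x))\<^sup>2) \<le> M" if "norm x \<le> 1" for x
    using neg that by (force simp: M_def)
  have "0 \<le> M" using M[of 0] by simp
  moreover have "(\<Sum>j\<in>F. (norm (C j x))\<^sup>2) \<le> M * (norm x)\<^sup>2" for x
  proof (cases "x = 0")
    case False
    have "(\<Sum>j\<in>F. (norm (C j (x /\<^sub>R norm x)))\<^sup>2) = (\<Sum>j\<in>F. (norm (C j x))\<^sup>2) / (norm x)\<^sup>2"
      by (simp add: blinfun.scaleR_right power_mult_distrib sum_distrib_left
          divide_inverse_commute power_inverse)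
    moreover have "(\<Sum>j\<in>F. (norm (C j (x /\<^sub>R norm x)))\<^sup>2) \<le> M"
      using False by (intro M) simp
    ultimately show ?thesis using False by (simp add: divide_le_eq)
  qed simp
  ultimately have "b \<le> M" by (rule big)
  with \<open>e > 0\<close> show False by (simp add: M_def)
qed

text \<open>For the column c x = (C_j x)_j the sum is D = c^* c, and |c|^2 <= M. Cauchy-Schwarz for
  <c x, c y> with y = D x gives the bound without forming the direct sum.\<close>

lemma norm_sum_adj_compose_le:
  fixes C :: "'j \<Rightarrow> 'a::chilbert_space \<Rightarrow>\<^sub>L 'a"
  assumes C: "\<And>j. j \<in> F \<Longrightarrow> C j \<in> bounded_ops" and M0: "0 \<le> M"
    and M: "\<And>x. (\<Sum>j\<in>F. (norm (C j x))\<^sup>2) \<le> M * (norm x)\<^sup>2"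
  shows "norm (\<Sum>j\<in>F. adj (C j) o\<^sub>L C j) \<le> M" (is "norm ?D \<le> M")
proof (rule norm_blinfun_bound[OF M0])
  have L: "L2_set (\<lambda>j. norm (C j x)) F \<le> sqrt M * norm x" for x
    using real_sqrt_le_mono[OF M[of x]] by (simp add: L2_set_def real_sqrt_mult)
  fix x
  have "norm (?D x) * norm (?D x) = cmod (cinner (?D x) (?D x))"
    by (simp add: cinner_self norm_mult power2_eq_square)
  also have "cinner (?D x) y = (\<Sum>j\<in>F. cinner (C j x) (C j y))" for y
    by (simp add: blinfun.sum_left cinner_sum_left cinner_adj'[OF C])
  then have "cmod (cinner (?D x) (?D x)) \<le> (\<Sum>j\<in>F. \<bar>norm (C j x)\<bar> * \<bar>norm (C j (?D x))\<bar>)"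
    by (auto intro!: sum_norm_le cmod_cinner_le)
  also have "\<dots> \<le> L2_set (\<lambda>j. norm (C j x)) F * L2_set (\<lambda>j. norm (C j (?D x))) F"
    by (rule L2_set_mult_ineq)
  also have "\<dots> \<le> (sqrt M * norm x) * (sqrt M * norm (?D x))"
    by (intro mult_mono L) (auto simp: M0)
  also have "\<dots> = M * norm x * norm (?D x)"
    using M0 by (simp add: algebra_simps)
  finally show "norm (?D x) \<le> M * norm x"
    by (cases "?D x = 0") (auto simp: M0)
qed

text \<open>The state has the value card F at D = sum_j C_j^* C_j and does not exceed |D| there,
  while |D| is at most any bound M for the squared norm of the column. \<open>A\<close> is left open
  so as to cover B(K) and the generated algebra alike.\<close>

lemma jointly_norming_if_state:
  fixes C :: "'j \<Rightarrow> 'a::chilbert_space \<Rightarrow>\<^sub>L 'a"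
  assumes "\<exists>x::'a. x \<noteq> 0"
    and A: "cstar_subalgebra A" and \<omega>: "is_state A \<omega>" and CA: "\<And>j. j \<in> J \<Longrightarrow> C j \<in> A"
    and C1: "\<And>j. j \<in> J \<Longrightarrow> norm (C j) \<le> 1" and one: "\<And>j. j \<in> J \<Longrightarrow> \<omega> (adj (C j) o\<^sub>L C j) = 1"
  shows "jointly_norming J C"
proof (rule jointly_normingI)
  fix F and e :: real assume F: "finite F" "F \<subseteq> J" "F \<noteq> {}" "e > 0"
  have sum: "(\<Sum>j\<in>F. adj (C j) o\<^sub>L C j) \<in> A \<and> \<omega> (\<Sum>j\<in>F. adj (C j) o\<^sub>L C j) = card F"
    using F(1,2)
  proof (induction F)
    case empty
    have "\<omega> 0 = 0" using state_bound[OF A \<omega> cstar_subalgebraD(2)[OF A]] by simp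
    then show ?case by (simp add: cstar_subalgebraD(2)[OF A])
  next
    case (insert j F)
    have "adj (C j) o\<^sub>L C j \<in> A" using CA insert by (simp add: cstar_subalgebraD[OF A])
    then show ?case
      using insert one \<omega> by (simp add: cstar_subalgebraD[OF A] is_state_def)
  qed
  then have "real (card F) \<le> norm (\<Sum>j\<in>F. adj (C j) o\<^sub>L C j)"
    using state_bound[OF A \<omega>, of "\<Sum>j\<in>F. adj (C j) o\<^sub>L C j"] by simp
  moreover have "C j \<in> bounded_ops" if "j \<in> F" for j
    using CA cstar_subalgebraD(1)[OF A] F that by blast
  ultimately show "\<exists>x. norm x \<le> 1 \<and> real (card F) - e < (\<Sum>j\<in>F. (norm (C j x))\<^sup>2)"
    using F norm_sum_adj_compose_le[of F C] order_trans by (intro norming_sum_vector) blast+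
qed (use assms in auto)

section \<open>From norming vectors to a state\<close>

text \<open>The state is a pointwise cluster point of vector states (Tychonoff).\<close>

lemma state_if_jointly_norming:
  fixes C :: "'j \<Rightarrow> 'a::chilbert_space \<Rightarrow>\<^sub>L 'a"
  assumes jn: "jointly_norming J C" and C: "\<And>j. j \<in> J \<Longrightarrow> C j \<in> bounded_ops"
    and C1: "\<And>j. j \<in> J \<Longrightarrow> norm (C j) \<le> 1"
  shows "\<exists>\<omega>. is_state bounded_ops \<omega> \<and> (\<forall>j\<in>J. \<omega> (adj (C j) o\<^sub>L C j) = 1)"
proof -
  have "\<exists>x. norm x = 1 \<and> (\<forall>j\<in>F. 1 - 1 / real (Suc n) < (norm (C j x))\<^sup>2)" if "finite F" "F \<subseteq> J" for F n
    using jn that unfolding jointly_norming_def by simp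
  then obtain u where u: "\<And>F n. finite F \<Longrightarrow> F \<subseteq> J \<Longrightarrow> norm (u F n) = 1"
    "\<And>F n j. finite F \<Longrightarrow> F \<subseteq> J \<Longrightarrow> j \<in> F \<Longrightarrow> 1 - 1 / real (Suc n) < (norm (C j (u F n)))\<^sup>2"
    by metis
  \<comment> \<open>Along \<open>N\<close> the finite set eventually contains any given j, while
    independently the tolerance 1 / (n + 1) tends to 0.\<close>
  define N where "N = finite_subsets_at_top J \<times>\<^sub>F (sequentially)"
  have N: "N \<noteq> bot" by (simp add: N_def prod_filter_eq_bot)
  define \<phi> where "\<phi> p T = cinner (blinfun_apply T (u (fst p) (snd p))) (u (fst p) (snd p))" for p T
  have evN: "\<forall>\<^sub>F p in N. norm (u (fst p) (snd p)) = 1"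
  proof -
    have "\<forall>\<^sub>F F in finite_subsets_at_top J. finite F \<and> F \<subseteq> J"
      by (rule eventually_finite_subsets_at_top_weakI) auto
    then have "\<forall>\<^sub>F p in N. finite (fst p) \<and> fst p \<subseteq> J"
      by (rule eventually_compose_filterlim) (simp add: N_def filterlim_fst)
    then show ?thesis by eventually_elim (rule u(1), auto)
  qed
  have lim1: "((\<lambda>p. \<phi> p (adj (C j) o\<^sub>L C j)) \<longlongrightarrow> 1) N" if j: "j \<in> J" for j
  proof -
    have "\<forall>\<^sub>F F in finite_subsets_at_top J. j \<in> F \<and> finite F \<and> F \<subseteq> J"
      unfolding eventually_finite_subsets_at_top using j by (intro exI[of _ "{j}"]) auto
    then have ev: "\<forall>\<^sub>F p in N. j \<in> fst p \<and> finite (fst p) \<and> fst p \<subseteq> J"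
      by (rule eventually_compose_filterlim) (simp add: N_def filterlim_fst)
    have "((\<lambda>p. (norm (C j (u (fst p) (snd p))))\<^sup>2) \<longlongrightarrow> 1) N"
    proof (rule tendsto_sandwich[where f = "\<lambda>p. 1 - 1 / real (Suc (snd p))" and h = "\<lambda>_. 1"])
      show "\<forall>\<^sub>F p in N. 1 - 1 / real (Suc (snd p)) \<le> (norm (C j (u (fst p) (snd p))))\<^sup>2"
        using ev by eventually_elim (rule less_imp_le, rule u(2), auto)
      show "\<forall>\<^sub>F p in N. (norm (C j (u (fst p) (snd p))))\<^sup>2 \<le> 1"
        using evN
      proof eventually_elim
        case (elim p)
        then have "norm (C j (u (fst p) (snd p))) \<le> 1"
          using norm_blinfun[of "C j" "u (fst p) (snd p)"] C1[OF j] by simp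
        then show ?case by (simp add: power_le_one)
      qed
      have "(\<lambda>n. 1 - 1 / real (Suc n)) \<longlonglongrightarrow> 1 - 0"
        by (intro tendsto_intros LIMSEQ_inverse_real_of_nat[unfolded inverse_eq_divide])
      then have lim: "(\<lambda>n. 1 - 1 / real (Suc n)) \<longlonglongrightarrow> 1" by simp
      have "filterlim snd sequentially N" unfolding N_def by (rule filterlim_snd)
      from filterlim_compose[OF lim this]
      show "((\<lambda>p. 1 - 1 / real (Suc (snd p))) \<longlongrightarrow> 1) N" .
    qed simp
    then have "((\<lambda>p. complex_of_real ((norm (C j (u (fst p) (snd p))))\<^sup>2)) \<longlongrightarrow> of_real 1) N"
      by (rule tendsto_of_real)
    then show ?thesis by (simp add: \<phi>_def cinner_adj'[OF C[OF j]] cinner_self)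
  qed
  \<comment> \<open>The disc of radius |T| contains the values of all vector states at T. The
    product is compact for pointwise convergence, and membership of \<open>\<omega>\<close> in it
    later gives |omega(T)| <= |T|.\<close>
  define K where "K = PiE UNIV (\<lambda>T :: 'a \<Rightarrow>\<^sub>L 'a. cball (0::complex) (norm T))"
  have "compactin (product_topology (\<lambda>T. euclidean) UNIV) K"
    unfolding K_def by (subst compactin_PiE) auto
  then have "compact K" by (simp add: euclidean_product_topology)
  moreover have "filtermap \<phi> N \<noteq> bot" using N by (simp add: filtermap_bot_iff)
  moreover have "\<forall>\<^sub>F f in filtermap \<phi> N. f \<in> K"
    unfolding eventually_filtermap using evN
  proof eventually_elim
    case (elim p)
    have "cmod (\<phi> p T) \<le> norm T" for T
      using cmod_cinner_le[of "T (u (fst p) (snd p))" "u (fst p) (snd p)"]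
        norm_blinfun[of T "u (fst p) (snd p)"] elim by (simp add: \<phi>_def)
    then show ?case by (simp add: K_def PiE_iff)
  qed
  ultimately obtain \<omega> where "\<omega> \<in> K" and H: "inf (nhds \<omega>) (filtermap \<phi> N) \<noteq> bot"
    using compact_filter[THEN iffD1, rule_format, of K "filtermap \<phi> N"] by blast
  \<comment> \<open>Along \<open>H\<close> the functionals converge pointwise to
    \<open>\<omega>\<close>, and whatever holds eventually for \<open>\<phi> p\<close> along
    \<open>N\<close> holds eventually along \<open>H\<close>; so identities and closed conditions
    pass to \<open>\<omega>\<close>.\<close>
  define H where "H = inf (nhds \<omega>) (filtermap \<phi> N)"
  have Hb: "H \<noteq> bot" using H by (simp add: H_def)
  have "((\<lambda>f. f T) \<longlongrightarrow> \<omega> T) (nhds \<omega>)" for T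
  proof (rule topological_tendstoI)
    fix S assume S: "open S" "\<omega> T \<in> S"
    have "open ((\<lambda>f. f T) -` S)"
      using S(1) by (rule open_vimage) (rule continuous_on_product_coordinates)
    then show "\<forall>\<^sub>F f in nhds \<omega>. f T \<in> S"
      using eventually_nhds_in_open[of "(\<lambda>f. f T) -` S" \<omega>] S by simp
  qed
  then have lim: "((\<lambda>f. f T) \<longlongrightarrow> \<omega> T) H" for T
    unfolding H_def by (meson inf_le1 tendsto_mono)
  have evH: "eventually P H" if "eventually (\<lambda>p. P (\<phi> p)) N" for P
    using that unfolding H_def by (metis eventually_filtermap filter_leD inf_le2)
  have eqI: "\<omega> S = c" if "((\<lambda>p. \<phi> p S) \<longlongrightarrow> c) N" for S c
  proof -
    have "((\<lambda>f. f S) \<longlongrightarrow> c) (filtermap \<phi> N)" using that by (simp add: filterlim_filtermap)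
    then have "((\<lambda>f. f S) \<longlongrightarrow> c) H" unfolding H_def by (meson inf_le2 tendsto_mono)
    then show ?thesis using lim Hb tendsto_unique by blast
  qed
  have add: "\<omega> (S + T) = \<omega> S + \<omega> T" for S T
  proof -
    have "\<forall>\<^sub>F f in H. f S + f T = f (S + T)"
      by (rule evH) (simp add: \<phi>_def blinfun.add_left cinner_add_left)
    then have "((\<lambda>f. f (S + T)) \<longlongrightarrow> \<omega> S + \<omega> T) H"
      by (rule Lim_transform_eventually[OF tendsto_add[OF lim lim]])
    then show ?thesis using lim Hb tendsto_unique by blast
  qed
  have scale: "\<omega> (scaleC_op c T) = c * \<omega> T" for c T
  proof -
    have "\<forall>\<^sub>F f in H. c * f T = f (scaleC_op c T)"
      by (rule evH) (simp add: \<phi>_def scaleC_op.rep_eq cinner_scaleC_left)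
    then have "((\<lambda>f. f (scaleC_op c T)) \<longlongrightarrow> c * \<omega> T) H"
      by (rule Lim_transform_eventually[OF tendsto_mult_left[OF lim]])
    then show ?thesis using lim Hb tendsto_unique by blast
  qed
  have pos: "\<omega> (adj T o\<^sub>L T) \<in> \<real>\<^sub>\<ge>\<^sub>0" if "T \<in> bounded_ops" for T
  proof (rule Lim_in_closed_set[OF _ _ Hb lim])
    show "\<forall>\<^sub>F f in H. f (adj T o\<^sub>L T) \<in> \<real>\<^sub>\<ge>\<^sub>0"
      by (rule evH) (simp add: \<phi>_def cinner_adj'[OF that] cinner_self)
  qed (rule closed_nonneg_Reals_complex)
  have bound: "cmod (\<omega> T) \<le> norm T" for T
    using \<open>\<omega> \<in> K\<close> by (auto simp: K_def PiE_iff)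
  \<comment> \<open>The identity lies in the unit ball of B(K), so the value 1 there keeps the norm
    of the limit from dropping.\<close>
  have unit: "\<omega> id_blinfun = 1"
  proof (rule eqI)
    have "\<forall>\<^sub>F p in N. 1 = \<phi> p id_blinfun"
      using evN by eventually_elim (simp add: \<phi>_def cinner_self)
    then show "((\<lambda>p. \<phi> p id_blinfun) \<longlongrightarrow> 1) N"
      by (rule Lim_transform_eventually[OF tendsto_const])
  qed
  let ?U = "{T \<in> bounded_ops. norm T \<le> 1} :: ('a \<Rightarrow>\<^sub>L 'a) set"
  have id: "id_blinfun \<in> ?U" by (simp add: bounded_ops_def norm_blinfun_id_le)
  have le: "cmod (\<omega> T) \<le> 1" if "T \<in> ?U" for T using bound[of T] that by simp
  have bdd: "bdd_above ((\<lambda>T. cmod (\<omega> T)) ` ?U)" using le by (auto simp: bdd_above_def)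
  have "(SUP T\<in>?U. cmod (\<omega> T)) = 1"
  proof (rule antisym)
    show "(SUP T\<in>?U. cmod (\<omega> T)) \<le> 1" using id le by (intro cSUP_least) auto
    show "1 \<le> (SUP T\<in>?U. cmod (\<omega> T))" using cSUP_upper[OF id bdd] by (simp add: unit)
  qed
  then have "is_state bounded_ops \<omega>"
    unfolding is_state_def using add scale pos bdd by simp
  moreover have "\<forall>j\<in>J. \<omega> (adj (C j) o\<^sub>L C j) = 1" using eqI lim1 by blast
  ultimately show ?thesis by blast
qed

text \<open>Linearity and positivity pass to subsets at once, but the norm may drop, for instance
  when the identity is lost. A single T in the unit ball of \<open>A\<close> with value 1 prevents
  this.\<close>

lemma is_state_restrict:
  assumes \<omega>: "is_state B \<omega>" and AB: "A \<subseteq> B" and T: "T \<in> A" "norm T \<le> 1" "\<omega> T = 1"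
  shows "is_state A \<omega>"
proof -
  let ?V = "\<lambda>X. {T \<in> X. norm T \<le> 1}" and ?f = "\<lambda>T. cmod (\<omega> T)"
  have bddB: "bdd_above (?f ` ?V B)" and supB: "(SUP T\<in>?V B. ?f T) = 1"
    using \<omega> by (auto simp: is_state_def)
  have bdd: "bdd_above (?f ` ?V A)"
    by (rule bdd_above_mono[OF bddB]) (use AB in blast)
  have "(SUP T\<in>?V A. ?f T) = 1"
  proof (rule antisym)
    have "(SUP T\<in>?V A. ?f T) \<le> (SUP T\<in>?V B. ?f T)"
      using AB T by (intro cSUP_subset_mono bddB) auto
    then show "(SUP T\<in>?V A. ?f T) \<le> 1" by (simp add: supB)
    show "1 \<le> (SUP T\<in>?V A. ?f T)" using cSUP_upper[OF _ bdd, of T] T by simp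
  qed
  moreover have "\<omega> (S + T) = \<omega> S + \<omega> T" "\<omega> (scaleC_op c T) = c * \<omega> T"
    "\<omega> (adj T o\<^sub>L T) \<in> \<real>\<^sub>\<ge>\<^sub>0" if "S \<in> A" "T \<in> A" for S T c
    using \<omega> AB that unfolding is_state_def by blast+
  ultimately show ?thesis using bdd unfolding is_state_def by simp
qed

section \<open>Norms of operator matrices\<close>

lemma L2_set_sq: "(L2_set f A)\<^sup>2 = (\<Sum>i\<in>A. (f i)\<^sup>2)"
  by (simp add: L2_set_def sum_nonneg)

lemma eq_cmod_if_of_real: "complex_of_real r = z \<Longrightarrow> 0 \<le> r \<Longrightarrow> r = cmod z"
  by (metis abs_of_nonneg norm_of_real)

text \<open>The real supremum in \<open>opmat_norm\<close> has a meaning only on bounded sets; the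
  crude sum of all entry norms provides a bound.\<close>

lemma bdd_above_opmat:
  fixes T :: "nat \<Rightarrow> nat \<Rightarrow> ('a::real_normed_vector \<Rightarrow>\<^sub>L 'a)"
  shows "bdd_above ((\<lambda>x. L2_set (\<lambda>i. norm (\<Sum>k<n. T i k (x k))) {..<n})
    ` {x. L2_set (\<lambda>k. norm (x k)) {..<n} \<le> 1})"
proof (rule bdd_aboveI2)
  fix x assume "x \<in> {x. L2_set (\<lambda>k. norm (x k :: 'a)) {..<n} \<le> 1}"
  then have x: "norm (x k) \<le> 1" if "k < n" for k
    using member_le_L2_set[of "{..<n}" k "\<lambda>k. norm (x k)"] that by simp
  have "L2_set (\<lambda>i. norm (\<Sum>k<n. T i k (x k))) {..<n} \<le> (\<Sum>i<n. norm (\<Sum>k<n. T i k (x k)))"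
    by (rule L2_set_le_sum) simp
  also have "\<dots> \<le> (\<Sum>i<n. \<Sum>k<n. norm (T i k))"
  proof (intro sum_mono sum_norm_le)
    fix i k assume "k \<in> {..<n}"
    then show "norm (T i k (x k)) \<le> norm (T i k)"
      using norm_blinfun[of "T i k" "x k"] mult_left_mono[OF x[of k], of "norm (T i k)"] by simp
  qed
  finally show "L2_set (\<lambda>i. norm (\<Sum>k<n. T i k (x k))) {..<n} \<le> (\<Sum>i<n. \<Sum>k<n. norm (T i k))" .
qed

lemma opmat_norm_upper:
  fixes T :: "nat \<Rightarrow> nat \<Rightarrow> ('a::real_normed_vector \<Rightarrow>\<^sub>L 'a)"
  shows "L2_set (\<lambda>i. norm (\<Sum>k<n. T i k (x k))) {..<n} \<le> opmat_norm n T * L2_set (\<lambda>k. norm (x k)) {..<n}"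
proof (cases "L2_set (\<lambda>k. norm (x k)) {..<n} = 0")
  case True
  then have "x k = 0" if "k < n" for k
    using that by (simp add: L2_set_eq_0_iff)
  then show ?thesis by (simp add: L2_set_def)
next
  case False
  define r where "r = L2_set (\<lambda>k. norm (x k)) {..<n}"
  have r: "r > 0" using False L2_set_nonneg[of "\<lambda>k. norm (x k)" "{..<n}"] by (simp add: r_def order_less_le)
  have scale: "L2_set (\<lambda>i. norm ((1 / r) *\<^sub>R f i)) {..<n} = (1 / r) * L2_set (\<lambda>i. norm (f i)) {..<n}"
    for f :: "nat \<Rightarrow> 'a"
    using r L2_set_right_distrib[of "1 / r" "\<lambda>i. norm (f i)" "{..<n}"] by simp
  have "L2_set (\<lambda>k. norm ((1 / r) *\<^sub>R x k)) {..<n} \<le> 1"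
    using r unfolding scale r_def[symmetric] by simp
  then have le: "L2_set (\<lambda>i. norm (\<Sum>k<n. T i k ((1 / r) *\<^sub>R x k))) {..<n} \<le> opmat_norm n T"
    unfolding opmat_norm_def by (intro cSUP_upper bdd_above_opmat) simp
  have eq: "(\<Sum>k<n. T i k ((1 / r) *\<^sub>R x k)) = (1 / r) *\<^sub>R (\<Sum>k<n. T i k (x k))" for i
    by (simp only: blinfun.scaleR_right scaleR_sum_right)
  show ?thesis using le r unfolding eq scale r_def[symmetric] by (simp add: divide_le_eq)
qed

lemma opmat_norm_least:
  fixes T :: "nat \<Rightarrow> nat \<Rightarrow> ('a::real_normed_vector \<Rightarrow>\<^sub>L 'a)"
  assumes "0 \<le> M"
    and "\<And>x. L2_set (\<lambda>i. norm (\<Sum>k<n. T i k (x k))) {..<n} \<le> M * L2_set (\<lambda>k. norm (x k)) {..<n}"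
  shows "opmat_norm n T \<le> M"
  unfolding opmat_norm_def
proof (rule cSUP_least)
  show "{x. L2_set (\<lambda>k. norm (x k :: 'a)) {..<n} \<le> 1} \<noteq> {}"
    by (auto intro!: exI[of _ "\<lambda>_. 0"] simp: L2_set_def)
  fix x :: "nat \<Rightarrow> 'a" assume "x \<in> {x. L2_set (\<lambda>k. norm (x k)) {..<n} \<le> 1}"
  then have "M * L2_set (\<lambda>k. norm (x k)) {..<n} \<le> M * 1"
    using assms(1) by (intro mult_left_mono) auto
  then show "L2_set (\<lambda>i. norm (\<Sum>k<n. T i k (x k))) {..<n} \<le> M"
    using assms(2)[of x] by simp
qed

lemma opmat_norm_nonneg:
  fixes T :: "nat \<Rightarrow> nat \<Rightarrow> ('a::real_normed_vector \<Rightarrow>\<^sub>L 'a)"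
  shows "0 \<le> opmat_norm n T"
proof -
  have "L2_set (\<lambda>i. norm (\<Sum>k<n. T i k 0)) {..<n} \<le> opmat_norm n T"
    unfolding opmat_norm_def by (rule cSUP_upper[OF _ bdd_above_opmat]) (simp add: L2_set_def)
  then show ?thesis by (simp add: L2_set_def)
qed

text \<open>The matrix \<open>\<beta> = a\<^sup>* a\<close>, where \<open>a\<close> has the rows \<open>a p\<close>, has norm \<open>\<parallel>a\<parallel>\<^sup>2\<close>.\<close>

lemma gram_form:
  fixes a :: "'p \<Rightarrow> nat \<Rightarrow> complex"
  shows "(\<Sum>i<n. (\<Sum>k<n. (\<Sum>p\<in>P. cnj (a p i) * a p k) * c k) * cnj (d i))
    = (\<Sum>p\<in>P. (\<Sum>k<n. a p k * c k) * cnj (\<Sum>i<n. a p i * d i))"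
proof -
  have "(\<Sum>i<n. (\<Sum>k<n. (\<Sum>p\<in>P. cnj (a p i) * a p k) * c k) * cnj (d i))
    = (\<Sum>i<n. \<Sum>k<n. \<Sum>p\<in>P. (a p k * c k) * cnj (a p i * d i))"
    by (simp add: sum_distrib_left sum_distrib_right mult_ac)
  also have "\<dots> = (\<Sum>i<n. \<Sum>p\<in>P. \<Sum>k<n. (a p k * c k) * cnj (a p i * d i))"
    by (intro sum.cong refl sum.swap)
  also have "\<dots> = (\<Sum>p\<in>P. \<Sum>i<n. \<Sum>k<n. (a p k * c k) * cnj (a p i * d i))"
    by (rule sum.swap)
  also have "\<dots> = (\<Sum>p\<in>P. (\<Sum>k<n. a p k * c k) * cnj (\<Sum>i<n. a p i * d i))"
    by (simp only: cnj_sum sum_product) (intro sum.cong refl sum.swap)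
  finally show ?thesis .
qed

text \<open>Taking d = c in the Gram form gives |a c|^2 = <beta c, c>, and Cauchy-Schwarz applies:
  this is |a|^2 <= |a^* a|.\<close>

lemma cmat_norm_gram_upper:
  fixes a :: "'p \<Rightarrow> nat \<Rightarrow> complex"
  shows "(\<Sum>p\<in>P. (cmod (\<Sum>k<n. a p k * c k))\<^sup>2)
    \<le> cmat_norm n (\<lambda>i k. \<Sum>p\<in>P. cnj (a p i) * a p k) * (\<Sum>k<n. (cmod (c k))\<^sup>2)"
proof -
  let ?\<beta> = "\<lambda>i k. \<Sum>p\<in>P. cnj (a p i) * a p k"
  have "complex_of_real (\<Sum>p\<in>P. (cmod (\<Sum>k<n. a p k * c k))\<^sup>2)
    = (\<Sum>i<n. (\<Sum>k<n. ?\<beta> i k * c k) * cnj (c i))"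
    unfolding gram_form of_real_sum complex_norm_square ..
  then have "(\<Sum>p\<in>P. (cmod (\<Sum>k<n. a p k * c k))\<^sup>2) = cmod (\<Sum>i<n. (\<Sum>k<n. ?\<beta> i k * c k) * cnj (c i))"
    by (rule eq_cmod_if_of_real) (simp add: sum_nonneg)
  also have "\<dots> \<le> (\<Sum>i<n. \<bar>cmod (\<Sum>k<n. ?\<beta> i k * c k)\<bar> * \<bar>cmod (c i)\<bar>)"
    by (rule sum_norm_le) (simp add: norm_mult)
  also have "\<dots> \<le> L2_set (\<lambda>i. cmod (\<Sum>k<n. ?\<beta> i k * c k)) {..<n} * L2_set (\<lambda>i. cmod (c i)) {..<n}"
    by (rule L2_set_mult_ineq)
  also have "\<dots> \<le> (cmat_norm n ?\<beta> * L2_set (\<lambda>i. cmod (c i)) {..<n}) * L2_set (\<lambda>i. cmod (c i)) {..<n}"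
    using opmat_norm_upper[where T = "\<lambda>i k. blinfun_mult_right (?\<beta> i k)" and x = c and n = n]
    by (intro mult_right_mono) (simp_all add: cmat_norm_def)
  finally show ?thesis by (simp add: mult.assoc flip: power2_eq_square L2_set_sq)
qed

text \<open>Cauchy-Schwarz bounds |beta c|^2 = <a c, a (beta c)> by M |c| |beta c|: this is |a^* a|
  <= |a|^2, with M standing for a bound of |a|^2.\<close>

lemma cmat_norm_gram_least:
  fixes a :: "'p \<Rightarrow> nat \<Rightarrow> complex"
  assumes M0: "0 \<le> M"
    and M: "\<And>c. (\<Sum>p\<in>P. (cmod (\<Sum>k<n. a p k * c k))\<^sup>2) \<le> M * (\<Sum>k<n. (cmod (c k))\<^sup>2)"
  shows "cmat_norm n (\<lambda>i k. \<Sum>p\<in>P. cnj (a p i) * a p k) \<le> M"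
  unfolding cmat_norm_def
proof (rule opmat_norm_least[OF M0])
  fix c :: "nat \<Rightarrow> complex"
  define d where "d i = (\<Sum>k<n. (\<Sum>p\<in>P. cnj (a p i) * a p k) * c k)" for i
  define u where "u c p = (\<Sum>k<n. a p k * c k)" for c p
  have L: "L2_set (\<lambda>p. cmod (u c p)) P \<le> sqrt M * L2_set (\<lambda>k. cmod (c k)) {..<n}" for c
    using real_sqrt_le_mono[OF M[of c]] by (simp add: L2_set_def u_def real_sqrt_mult)
  have "complex_of_real (\<Sum>i<n. (cmod (d i))\<^sup>2) = (\<Sum>i<n. d i * cnj (d i))"
    unfolding of_real_sum complex_norm_square ..
  also have "\<dots> = (\<Sum>p\<in>P. u c p * cnj (u d p))"
    using gram_form[where c = c and d = d and n = n and P = P and a = a] by (simp only: d_def u_def)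
  finally have "(\<Sum>i<n. (cmod (d i))\<^sup>2) = cmod (\<Sum>p\<in>P. u c p * cnj (u d p))"
    by (rule eq_cmod_if_of_real) (simp add: sum_nonneg)
  also have "\<dots> \<le> (\<Sum>p\<in>P. \<bar>cmod (u c p)\<bar> * \<bar>cmod (u d p)\<bar>)"
    by (rule sum_norm_le) (simp add: norm_mult)
  also have "\<dots> \<le> L2_set (\<lambda>p. cmod (u c p)) P * L2_set (\<lambda>p. cmod (u d p)) P"
    by (rule L2_set_mult_ineq)
  also have "\<dots> \<le> (sqrt M * L2_set (\<lambda>k. cmod (c k)) {..<n}) * (sqrt M * L2_set (\<lambda>k. cmod (d k)) {..<n})"
    by (intro mult_mono L) (auto simp: M0 L2_set_nonneg)
  also have "\<dots> = M * L2_set (\<lambda>k. cmod (c k)) {..<n} * L2_set (\<lambda>k. cmod (d k)) {..<n}"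
    using M0 by (simp add: algebra_simps)
  finally have le: "L2_set (\<lambda>i. cmod (d i)) {..<n} * L2_set (\<lambda>i. cmod (d i)) {..<n}
      \<le> M * L2_set (\<lambda>k. cmod (c k)) {..<n} * L2_set (\<lambda>k. cmod (d k)) {..<n}"
    by (simp flip: power2_eq_square L2_set_sq)
  have "L2_set (\<lambda>i. cmod (d i)) {..<n} \<le> M * L2_set (\<lambda>k. cmod (c k)) {..<n}"
  proof (cases "L2_set (\<lambda>i. cmod (d i)) {..<n} = 0")
    case True
    then show ?thesis using M0 by (simp add: L2_set_nonneg)
  next
    case False
    then have "L2_set (\<lambda>i. cmod (d i)) {..<n} > 0"
      using L2_set_nonneg[of "\<lambda>i. cmod (d i)" "{..<n}"] by linarith
    then show ?thesis using le by (rule mult_right_le_imp_le[rotated])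
  qed
  then show "L2_set (\<lambda>i. cmod (\<Sum>k<n. blinfun_mult_right (\<Sum>p\<in>P. cnj (a p i) * a p k) (c k))) {..<n}
      \<le> M * L2_set (\<lambda>k. cmod (c k)) {..<n}"
    by (simp add: d_def)
qed

text \<open>The vectors e_r are left unnormalized and may vanish, so linearly dependent x_k call for
  no special treatment.\<close>

lemma gram_schmidt:
  fixes x :: "nat \<Rightarrow> 'a::chilbert_space"
  shows "\<exists>e c. (\<forall>r<n. \<forall>s<n. r \<noteq> s \<longrightarrow> cinner (e r) (e s) = 0) \<and>
    (\<forall>k<n. x k = (\<Sum>r<n. c k r *\<^sub>C e r))"
proof (induction n)
  case (Suc n)
  then obtain e c where e: "\<And>r s. r < n \<Longrightarrow> s < n \<Longrightarrow> r \<noteq> s \<Longrightarrow> cinner (e r) (e s) = 0"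
    and x: "\<And>k. k < n \<Longrightarrow> x k = (\<Sum>r<n. c k r *\<^sub>C e r)" by blast
  \<comment> \<open>If e_r = 0 the quotient is 0 by the convention for division by zero, which is
    harmless because <x_n, e_r> = 0 as well.\<close>
  define q where "q r = cinner (x n) (e r) / complex_of_real ((norm (e r))\<^sup>2)" for r
  define y where "y = x n - (\<Sum>r<n. q r *\<^sub>C e r)"
  have y: "cinner y (e s) = 0" if s: "s < n" for s
  proof -
    have "(\<Sum>r<n. q r * cinner (e r) (e s)) = (\<Sum>r<n. if r = s then q r * cinner (e r) (e s) else 0)"
      using e s by (intro sum.cong) auto
    then have "(\<Sum>r<n. q r * cinner (e r) (e s)) = q s * cinner (e s) (e s)"
      using s by simp
    also have "\<dots> = cinner (x n) (e s)"
      by (cases "e s = 0") (simp_all add: q_def cinner_self)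
    finally show ?thesis
      by (simp add: y_def cinner_diff_left cinner_sum_left cinner_scaleC_left)
  qed
  then have y': "cinner (e s) y = 0" if "s < n" for s
    using that by (metis cinner_commute complex_cnj_zero)
  let ?e = "e(n := y)"
  let ?c = "\<lambda>k r. if k < n then (if r < n then c k r else 0) else (if r < n then q r else 1)"
  have "\<forall>r<Suc n. \<forall>s<Suc n. r \<noteq> s \<longrightarrow> cinner (?e r) (?e s) = 0"
    using e y y' by (auto simp: less_Suc_eq)
  moreover have "\<forall>k<Suc n. x k = (\<Sum>r<Suc n. ?c k r *\<^sub>C ?e r)"
    using x by (auto simp: less_Suc_eq y_def)
  ultimately show ?case by (intro exI conjI)
qed simp

lemma pythagoras:
  fixes e :: "nat \<Rightarrow> 'a::chilbert_space"
  assumes "\<And>r s. r < n \<Longrightarrow> s < n \<Longrightarrow> r \<noteq> s \<Longrightarrow> cinner (e r) (e s) = 0"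
  shows "(norm (\<Sum>r<n. a r *\<^sub>C e r))\<^sup>2 = (\<Sum>r<n. (cmod (a r))\<^sup>2 * (norm (e r))\<^sup>2)"
  using assms
proof (induction n)
  case (Suc n)
  have "cinner (\<Sum>r<n. a r *\<^sub>C e r) (a n *\<^sub>C e n) = 0"
    using Suc.prems by (simp add: cinner_sum_left cinner_scaleC_left cinner_scaleC_right)
  then show ?case using Suc by (simp add: norm_add_sq norm_scaleC power_mult_distrib)
qed simp

text \<open>A scalar matrix has the same norm on \<open>K\<^sup>n\<close> as on \<open>\<complex>\<^sup>n\<close>: expand the vectors in an
  orthogonal family of \<open>K\<close>.\<close>

lemma scalar_rows_vector_bound:
  fixes a :: "'p \<Rightarrow> nat \<Rightarrow> complex" and x :: "nat \<Rightarrow> 'a::chilbert_space"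
  assumes M: "\<And>c. (\<Sum>p\<in>P. (cmod (\<Sum>k<n. a p k * c k))\<^sup>2) \<le> M * (\<Sum>k<n. (cmod (c k))\<^sup>2)"
  shows "(\<Sum>p\<in>P. (norm (\<Sum>k<n. a p k *\<^sub>C x k))\<^sup>2) \<le> M * (\<Sum>k<n. (norm (x k))\<^sup>2)"
proof -
  obtain e c where e: "\<And>r s. r < n \<Longrightarrow> s < n \<Longrightarrow> r \<noteq> s \<Longrightarrow> cinner (e r) (e s) = 0"
    and x: "\<And>k. k < n \<Longrightarrow> x k = (\<Sum>r<n. c k r *\<^sub>C e r)"
    using gram_schmidt[of n x] by blast
  have row: "(\<Sum>k<n. a p k *\<^sub>C x k) = (\<Sum>r<n. (\<Sum>k<n. a p k * c k r) *\<^sub>C e r)" for p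
  proof -
    have "(\<Sum>k<n. a p k *\<^sub>C x k) = (\<Sum>k<n. \<Sum>r<n. (a p k * c k r) *\<^sub>C e r)"
      by (simp add: x scaleC_sum_right scaleC_scaleC)
    also have "\<dots> = (\<Sum>r<n. \<Sum>k<n. (a p k * c k r) *\<^sub>C e r)" by (rule sum.swap)
    finally show ?thesis by (simp add: scaleC_sum_left)
  qed
  have "(\<Sum>p\<in>P. (norm (\<Sum>k<n. a p k *\<^sub>C x k))\<^sup>2)
      = (\<Sum>p\<in>P. \<Sum>r<n. (cmod (\<Sum>k<n. a p k * c k r))\<^sup>2 * (norm (e r))\<^sup>2)"
    unfolding row using pythagoras[OF e] by simp
  also have "\<dots> = (\<Sum>r<n. (\<Sum>p\<in>P. (cmod (\<Sum>k<n. a p k * c k r))\<^sup>2) * (norm (e r))\<^sup>2)"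
    by (subst sum.swap) (simp add: sum_distrib_right)
  \<comment> \<open>The scalar bound is applied, for each r separately, to the coefficient vector k
    |-> \<open>c k r\<close>.\<close>
  also have "\<dots> \<le> (\<Sum>r<n. (M * (\<Sum>k<n. (cmod (c k r))\<^sup>2)) * (norm (e r))\<^sup>2)"
    by (intro sum_mono mult_right_mono M) simp
  also have "\<dots> = M * (\<Sum>r<n. \<Sum>k<n. (cmod (c k r))\<^sup>2 * (norm (e r))\<^sup>2)"
    by (simp add: sum_distrib_left sum_distrib_right mult.assoc)
  also have "(\<Sum>r<n. \<Sum>k<n. (cmod (c k r))\<^sup>2 * (norm (e r))\<^sup>2)
      = (\<Sum>k<n. \<Sum>r<n. (cmod (c k r))\<^sup>2 * (norm (e r))\<^sup>2)" by (rule sum.swap)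
  also have "\<dots> = (\<Sum>k<n. (norm (x k))\<^sup>2)"
    using x pythagoras[OF e] by simp
  finally show ?thesis .
qed


section \<open>Column orthogonality\<close>

lemma op_le_sum_adj_iff:
  fixes C :: "'j \<Rightarrow> 'a::chilbert_space \<Rightarrow>\<^sub>L 'a"
  assumes C: "\<And>j. j \<in> F \<Longrightarrow> C j \<in> bounded_ops"
  shows "op_le (\<Sum>j\<in>F. C j o\<^sub>L adj (C j)) id_blinfun
    \<longleftrightarrow> (\<forall>w. (\<Sum>j\<in>F. (norm (adj (C j) w))\<^sup>2) \<le> (norm w)\<^sup>2)"
proof -
  have eq: "cinner ((id_blinfun - (\<Sum>j\<in>F. C j o\<^sub>L adj (C j))) w) w
      = complex_of_real ((norm w)\<^sup>2 - (\<Sum>j\<in>F. (norm (adj (C j) w))\<^sup>2))" for w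
    by (simp add: blinfun.diff_left blinfun.sum_left cinner_diff_left cinner_sum_left
        cinner_adj[OF C] cinner_self)
  show ?thesis by (simp only: op_le_def eq nonneg_Reals_of_real_iff) simp
qed

text \<open>The row y |-> sum_j C_j y_j has the adjoint w |-> (C_j^* w)_j, and an operator and its
  adjoint are contractions together. Each direction is a Cauchy-Schwarz argument; in the second the
  row is tested at y_j = C_j^* w.\<close>

lemma row_contraction_iff:
  fixes C :: "'j \<Rightarrow> 'a::chilbert_space \<Rightarrow>\<^sub>L 'a"
  assumes C: "\<And>j. j \<in> F \<Longrightarrow> C j \<in> bounded_ops"
  shows "(\<forall>w. (\<Sum>j\<in>F. (norm (adj (C j) w))\<^sup>2) \<le> (norm w)\<^sup>2)
    \<longleftrightarrow> (\<forall>y. (norm (\<Sum>j\<in>F. C j (y j)))\<^sup>2 \<le> (\<Sum>j\<in>F. (norm (y j))\<^sup>2))"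
proof (intro iffI allI)
  fix y assume adj: "\<forall>w. (\<Sum>j\<in>F. (norm (adj (C j) w))\<^sup>2) \<le> (norm w)\<^sup>2"
  define s where "s = (\<Sum>j\<in>F. C j (y j))"
  have "norm s * norm s = cmod (cinner s s)"
    by (simp add: cinner_self norm_mult power2_eq_square)
  also have "cinner s s = (\<Sum>j\<in>F. cinner (y j) (adj (C j) s))"
    unfolding s_def by (simp add: cinner_sum_left cinner_adj[OF C])
  also have "cmod \<dots> \<le> (\<Sum>j\<in>F. \<bar>norm (y j)\<bar> * \<bar>norm (adj (C j) s)\<bar>)"
    by (rule sum_norm_le) (simp add: cmod_cinner_le)
  also have "\<dots> \<le> L2_set (\<lambda>j. norm (y j)) F * L2_set (\<lambda>j. norm (adj (C j) s)) F"
    by (rule L2_set_mult_ineq)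
  also have "\<dots> \<le> L2_set (\<lambda>j. norm (y j)) F * norm s"
    using adj by (intro mult_left_mono L2_set_nonneg) (simp add: L2_set_def real_le_lsqrt)
  finally have "norm s \<le> L2_set (\<lambda>j. norm (y j)) F"
    by (cases "norm s = 0") (auto simp: L2_set_nonneg)
  then show "(norm (\<Sum>j\<in>F. C j (y j)))\<^sup>2 \<le> (\<Sum>j\<in>F. (norm (y j))\<^sup>2)"
    unfolding s_def L2_set_sq[symmetric] by (intro power_mono) auto
next
  fix w assume row: "\<forall>y. (norm (\<Sum>j\<in>F. C j (y j)))\<^sup>2 \<le> (\<Sum>j\<in>F. (norm (y j))\<^sup>2)"
  define S where "S = L2_set (\<lambda>j. norm (adj (C j) w)) F"
  have S0: "0 \<le> S" by (simp add: S_def L2_set_nonneg)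
  define v where "v = (\<Sum>j\<in>F. C j (adj (C j) w))"
  have "complex_of_real (S\<^sup>2) = cinner v w"
    by (simp add: S_def v_def L2_set_sq cinner_sum_left cinner_adj[OF C] cinner_self)
  then have "S\<^sup>2 = cmod (cinner v w)"
    by (rule eq_cmod_if_of_real) simp
  also have "\<dots> \<le> norm v * norm w" by (rule cmod_cinner_le)
  also have "norm v \<le> S"
  proof (rule power2_le_imp_le)
    show "(norm v)\<^sup>2 \<le> S\<^sup>2" unfolding S_def L2_set_sq v_def using row[rule_format, of "\<lambda>j. adj (C j) w"] .
  qed (rule S0)
  then have "norm v * norm w \<le> S * norm w" by (rule mult_right_mono) simp
  finally have "S \<le> norm w" using S0 by (cases "S = 0") (auto simp: power2_eq_square)
  then show "(\<Sum>j\<in>F. (norm (adj (C j) w))\<^sup>2) \<le> (norm w)\<^sup>2"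
    unfolding L2_set_sq[symmetric] S_def[symmetric] using S0 by (intro power_mono)
qed

text \<open>Complex linearity lets the scalars pass through C_j, so the operator matrix factors into
  the scalar matrices alpha_j followed by the row of the C_j. The two factors can then be estimated
  separately.\<close>

lemma column_apply:
  assumes C: "\<And>j. j \<in> F \<Longrightarrow> C j \<in> bounded_ops"
  shows "(\<Sum>k<n. (\<Sum>j\<in>F. mat_tensor (\<alpha> j) (C j) i k) (x k)) = (\<Sum>j\<in>F. C j (\<Sum>k<n. \<alpha> j i k *\<^sub>C x k))"
proof -
  have "(\<Sum>k<n. (\<Sum>j\<in>F. mat_tensor (\<alpha> j) (C j) i k) (x k)) = (\<Sum>k<n. \<Sum>j\<in>F. C j (\<alpha> j i k *\<^sub>C x k))"
    using C by (simp add: blinfun.sum_left mat_tensor_def scaleC_op.rep_eq bounded_ops_def)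
  also have "\<dots> = (\<Sum>j\<in>F. \<Sum>k<n. C j (\<alpha> j i k *\<^sub>C x k))" by (rule sum.swap)
  finally show ?thesis by (simp add: blinfun.sum_right)
qed

text \<open>Stacking the \<open>\<alpha> j\<close> gives one tall matrix with rows indexed by pairs
  of j and a row number; the sum of the alpha_j^* alpha_j is its Gram matrix.\<close>

lemma sum_cmat_mult_adj:
  "(\<Sum>j\<in>F. cmat_mult n (cmat_adj (\<alpha> j)) (\<alpha> j) i k)
    = (\<Sum>p\<in>F \<times> {..<n}. cnj (\<alpha> (fst p) (snd p) i) * \<alpha> (fst p) (snd p) k)"
  by (simp add: cmat_mult_def cmat_adj_def sum.cartesian_product split_beta)

lemma column_orthogonal_finite_iff:
  fixes C :: "'j \<Rightarrow> 'a::chilbert_space \<Rightarrow>\<^sub>L 'a"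
  assumes "\<And>j. j \<in> F \<Longrightarrow> norm (C j) = 1"
  shows "column_orthogonal_finite F C \<longleftrightarrow>
    (\<forall>n \<alpha>. (opmat_norm n (\<lambda>i k. \<Sum>j\<in>F. mat_tensor (\<alpha> j) (C j) i k))\<^sup>2
      = cmat_norm n (\<lambda>i k. \<Sum>p\<in>F \<times> {..<n}. cnj (\<alpha> (fst p) (snd p) i) * \<alpha> (fst p) (snd p) k))"
proof -
  have "\<not> (\<exists>j\<in>F. C j = 0)" using assms by force
  moreover have "(\<Sum>j\<in>F. mat_tensor (\<alpha> j) (inverse (norm (C j)) *\<^sub>R C j) i k)
      = (\<Sum>j\<in>F. mat_tensor (\<alpha> j) (C j) i k)" for \<alpha> i k
    using assms by (intro sum.cong) auto
  ultimately show ?thesis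
    unfolding column_orthogonal_finite_def sum_cmat_mult_adj by simp
qed

section \<open>From norming vectors to column orthogonality\<close>

lemma jointly_norming_sequence:
  fixes C :: "'j \<Rightarrow> 'a::chilbert_space \<Rightarrow>\<^sub>L 'a"
  assumes C: "\<And>j. j \<in> F \<Longrightarrow> C j \<in> bounded_ops" and C1: "\<And>j. j \<in> F \<Longrightarrow> norm (C j) \<le> 1"
    and F: "finite F" and jn: "jointly_norming F C"
    and row: "\<And>w. (\<Sum>j\<in>F. (norm (adj (C j) w))\<^sup>2) \<le> (norm w)\<^sup>2"
  obtains x where "\<And>m. norm (x m) = 1"
    "\<And>i j. i \<in> F \<Longrightarrow> j \<in> F \<Longrightarrow> (\<lambda>m. cinner (C i (x m)) (C j (x m))) \<longlonglongrightarrow> of_bool (i = j)"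
proof -
  have "\<exists>x. norm x = 1 \<and> (\<forall>j\<in>F. 1 - 1 / real (Suc m) < (norm (C j x))\<^sup>2)" for m
    using jn F unfolding jointly_norming_def by simp
  then obtain x where x1: "\<And>m. norm (x m) = 1"
    and x: "\<And>m j. j \<in> F \<Longrightarrow> 1 - 1 / real (Suc m) < (norm (C j (x m)))\<^sup>2" by metis
  have lim0: "(\<lambda>m. 1 / real (Suc m)) \<longlonglongrightarrow> 0"
    by (rule LIMSEQ_inverse_real_of_nat[unfolded inverse_eq_divide])
  have le1: "(norm (C j (x m)))\<^sup>2 \<le> 1" if "j \<in> F" for j m
  proof -
    have "norm (C j (x m)) \<le> 1"
      using norm_blinfun[of "C j" "x m"] C1[OF that] x1[of m] by simp
    then show ?thesis by (simp add: power_le_one)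
  qed
  have "(\<lambda>m. cinner (C i (x m)) (C j (x m))) \<longlonglongrightarrow> of_bool (i = j)" if i: "i \<in> F" and j: "j \<in> F" for i j
  proof (cases "i = j")
    case True
    have "(\<lambda>m. (norm (C j (x m)))\<^sup>2) \<longlonglongrightarrow> 1"
    proof (rule tendsto_sandwich[where f = "\<lambda>m. 1 - 1 / real (Suc m)" and h = "\<lambda>_. 1"])
      show "(\<lambda>m. 1 - 1 / real (Suc m)) \<longlonglongrightarrow> 1"
        using tendsto_diff[OF tendsto_const[of 1] lim0] by simp
    qed (use x[OF j] le1[OF j] in \<open>auto intro!: always_eventually less_imp_le\<close>)
    then have "(\<lambda>m. complex_of_real ((norm (C j (x m)))\<^sup>2)) \<longlonglongrightarrow> of_real 1"
      by (rule tendsto_of_real)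
    then show ?thesis using True by (simp add: cinner_self)
  next
    case False
    \<comment> \<open>Let d = 1 / (m + 1) and w = C_i x_m. Since <C_i^* w, x_m> = |w|^2 > 1 - d,
      already |C_i^* w|^2 >= (1 - d)^2. The row condition at w leaves at most 1 - (1 - d)^2 <= 2 d
      for |C_j^* w|^2, which dominates |<w, C_j x_m>|^2.\<close>
    have bound: "(cmod (cinner (C i (x m)) (C j (x m))))\<^sup>2 \<le> 2 * (1 / real (Suc m))" for m
    proof -
      define d where "d = 1 / real (Suc m)"
      have d: "0 \<le> d" "d \<le> 1" by (simp_all add: d_def)
      define w where "w = C i (x m)"
      have "cinner w (C j (x m)) = cinner (adj (C j) w) (x m)"
        by (simp add: cinner_adj'[OF C[OF j]])
      then have "cmod (cinner w (C j (x m))) \<le> norm (adj (C j) w)"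
        using cmod_cinner_le[of "adj (C j) w" "x m"] by (simp add: x1)
      then have "(cmod (cinner w (C j (x m))))\<^sup>2 \<le> (norm (adj (C j) w))\<^sup>2" by (simp add: power_mono)
      moreover have "(norm (adj (C i) w))\<^sup>2 + (norm (adj (C j) w))\<^sup>2 \<le> 1"
      proof -
        have "(\<Sum>k\<in>{i, j}. (norm (adj (C k) w))\<^sup>2) \<le> (\<Sum>k\<in>F. (norm (adj (C k) w))\<^sup>2)"
          using i j F by (intro sum_mono2) auto
        then show ?thesis using False row[of w] le1[OF i, of m] by (simp add: w_def)
      qed
      moreover have "(1 - d)\<^sup>2 \<le> (norm (adj (C i) w))\<^sup>2"
      proof (rule power_mono)
        have "cinner (adj (C i) w) (x m) = complex_of_real ((norm w)\<^sup>2)"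
          by (simp add: cinner_adj'[OF C[OF i]] cinner_self w_def)
        then have "cmod (cinner (adj (C i) w) (x m)) = cmod (complex_of_real ((norm w)\<^sup>2))" by (rule arg_cong)
        then have "cmod (cinner (adj (C i) w) (x m)) = (norm w)\<^sup>2"
          by (simp only: norm_of_real abs_power2)
        then have "(norm w)\<^sup>2 \<le> norm (adj (C i) w)"
          using cmod_cinner_le[of "adj (C i) w" "x m"] by (simp add: x1)
        then show "1 - d \<le> norm (adj (C i) w)" using x[OF i, of m] by (simp add: w_def d_def)
      qed (use d in simp)
      moreover have "1 - (1 - d)\<^sup>2 \<le> 2 * d"
        by (simp add: power2_eq_square algebra_simps)
      ultimately show ?thesis unfolding d_def[symmetric] w_def[symmetric] by linarith
    qed
    have "(\<lambda>m. (cmod (cinner (C i (x m)) (C j (x m))))\<^sup>2) \<longlonglongrightarrow> 0"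
    proof (rule tendsto_sandwich[where f = "\<lambda>_. 0" and h = "\<lambda>m. 2 * (1 / real (Suc m))"])
      show "(\<lambda>m. 2 * (1 / real (Suc m))) \<longlonglongrightarrow> 0"
        using tendsto_mult_left[OF lim0, of 2] by simp
    qed (use bound in \<open>auto intro!: always_eventually\<close>)
    from tendsto_real_sqrt[OF this]
    have "(\<lambda>m. cmod (cinner (C i (x m)) (C j (x m)))) \<longlonglongrightarrow> 0" by simp
    then have "(\<lambda>m. cinner (C i (x m)) (C j (x m))) \<longlonglongrightarrow> 0"
      by (rule tendsto_norm_zero_cancel)
    then show ?thesis using False by simp
  qed
  with x1 that show ?thesis by blast
qed

lemma column_orthogonal_finite_if:
  fixes C :: "'j \<Rightarrow> 'a::chilbert_space \<Rightarrow>\<^sub>L 'a"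
  assumes C: "\<And>j. j \<in> F \<Longrightarrow> C j \<in> bounded_ops" and C1: "\<And>j. j \<in> F \<Longrightarrow> norm (C j) = 1"
    and F: "finite F" and jn: "jointly_norming F C"
    and adj: "\<And>w. (\<Sum>j\<in>F. (norm (adj (C j) w))\<^sup>2) \<le> (norm w)\<^sup>2"
  shows "column_orthogonal_finite F C"
proof (subst column_orthogonal_finite_iff, (rule C1, assumption), intro allI)
  fix n :: nat and \<alpha> :: "'j \<Rightarrow> nat \<Rightarrow> nat \<Rightarrow> complex"
  define a where "a p = \<alpha> (fst p) (snd p)" for p
  let ?P = "F \<times> {..<n}"
  define \<beta> where "\<beta> = cmat_norm n (\<lambda>i k. \<Sum>p\<in>?P. cnj (a p i) * a p k)"
  define \<tau> where "\<tau> = opmat_norm n (\<lambda>i k. \<Sum>j\<in>F. mat_tensor (\<alpha> j) (C j) i k)"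
  have row: "(norm (\<Sum>j\<in>F. C j (y j)))\<^sup>2 \<le> (\<Sum>j\<in>F. (norm (y j))\<^sup>2)" for y
    using row_contraction_iff[of F C] C adj by blast
  have \<tau>0: "0 \<le> \<tau>" by (simp add: \<tau>_def opmat_norm_nonneg)
  have \<beta>0: "0 \<le> \<beta>" by (simp add: \<beta>_def cmat_norm_def opmat_norm_nonneg)
  \<comment> \<open>\<open>\<beta>\<close> is the squared norm of the stacked matrix of the alpha_j.
    The row contraction, used in each of the n coordinates, removes the C_j; what remains is that
    matrix acting on vectors of K^n.\<close>
  have "\<tau> \<le> sqrt \<beta>"
    unfolding \<tau>_def
  proof (rule opmat_norm_least)
    fix x :: "nat \<Rightarrow> 'a"
    define y where "y i j = (\<Sum>k<n. \<alpha> j i k *\<^sub>C x k)" for i j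
    have "(\<Sum>i<n. (norm (\<Sum>j\<in>F. C j (y i j)))\<^sup>2) \<le> (\<Sum>i<n. \<Sum>j\<in>F. (norm (y i j))\<^sup>2)"
      by (intro sum_mono row)
    also have "\<dots> = (\<Sum>p\<in>?P. (norm (\<Sum>k<n. a p k *\<^sub>C x k))\<^sup>2)"
      by (subst sum.swap) (simp add: sum.cartesian_product split_beta y_def a_def)
    also have "\<dots> \<le> \<beta> * (\<Sum>k<n. (norm (x k))\<^sup>2)"
      unfolding \<beta>_def by (rule scalar_rows_vector_bound[OF cmat_norm_gram_upper])
    finally have "sqrt (\<Sum>i<n. (norm (\<Sum>j\<in>F. C j (y i j)))\<^sup>2) \<le> sqrt (\<beta> * (\<Sum>k<n. (norm (x k))\<^sup>2))"
      by (rule real_sqrt_le_mono)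
    then show "L2_set (\<lambda>i. norm (\<Sum>k<n. (\<Sum>j\<in>F. mat_tensor (\<alpha> j) (C j) i k) (x k))) {..<n}
        \<le> sqrt \<beta> * L2_set (\<lambda>k. norm (x k)) {..<n}"
      by (simp add: column_apply[OF C] L2_set_def real_sqrt_mult y_def)
  qed (simp add: \<beta>0)
  then have "\<tau>\<^sup>2 \<le> (sqrt \<beta>)\<^sup>2" using \<tau>0 by (rule power_mono)
  then have le: "\<tau>\<^sup>2 \<le> \<beta>" using \<beta>0 by simp
  obtain x where x1: "\<And>m. norm (x m) = 1" and
    x: "\<And>i j. i \<in> F \<Longrightarrow> j \<in> F \<Longrightarrow> (\<lambda>m. cinner (C i (x m)) (C j (x m))) \<longlonglongrightarrow> of_bool (i = j)"
    using jointly_norming_sequence[OF C _ F jn adj] C1 by (metis order_refl)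
  have "\<beta> \<le> \<tau>\<^sup>2"
    unfolding \<beta>_def
  proof (rule cmat_norm_gram_least)
    fix c :: "nat \<Rightarrow> complex"
    define u where "u j i = (\<Sum>k<n. \<alpha> j i k * c k)" for j i
    \<comment> \<open>In the expansion of the square only the diagonal survives, as the C_j x_m
      become orthonormal.\<close>
    have lim: "(\<lambda>m. (norm (\<Sum>j\<in>F. u j i *\<^sub>C C j (x m)))\<^sup>2) \<longlonglongrightarrow> (\<Sum>j\<in>F. (cmod (u j i))\<^sup>2)" for i
    proof -
      have "(\<lambda>m. \<Sum>j\<in>F. \<Sum>k\<in>F. u j i * (cnj (u k i) * cinner (C j (x m)) (C k (x m))))
          \<longlonglongrightarrow> (\<Sum>j\<in>F. \<Sum>k\<in>F. u j i * (cnj (u k i) * of_bool (j = k)))"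
        by (intro tendsto_sum tendsto_mult tendsto_const x)
      also have "(\<Sum>j\<in>F. \<Sum>k\<in>F. u j i * (cnj (u k i) * of_bool (j = k))) = (\<Sum>j\<in>F. u j i * cnj (u j i))"
        using F by (simp add: of_bool_def if_distrib cong: if_cong)
      also have "\<dots> = complex_of_real (\<Sum>j\<in>F. (cmod (u j i))\<^sup>2)"
        unfolding of_real_sum complex_norm_square ..
      also have "(\<lambda>m. \<Sum>j\<in>F. \<Sum>k\<in>F. u j i * (cnj (u k i) * cinner (C j (x m)) (C k (x m))))
          = (\<lambda>m. complex_of_real ((norm (\<Sum>j\<in>F. u j i *\<^sub>C C j (x m)))\<^sup>2))"
        by (rule ext, subst cinner_self[symmetric],
            simp add: cinner_sum_left cinner_sum_right cinner_scaleC_left cinner_scaleC_right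
              sum_distrib_left mult.left_commute)
          (rule sum.swap)
      finally show ?thesis by (simp only: tendsto_of_real_iff)
    qed
    have "(\<lambda>m. \<Sum>i<n. (norm (\<Sum>j\<in>F. u j i *\<^sub>C C j (x m)))\<^sup>2) \<longlonglongrightarrow> (\<Sum>i<n. \<Sum>j\<in>F. (cmod (u j i))\<^sup>2)"
      by (intro tendsto_sum lim)
    \<comment> \<open>The test vector with entries c_k x_m has norm |c| because x_m is a unit
      vector. The bound is uniform in m, with c fixed, so it survives the limit.\<close>
    moreover have "(\<Sum>i<n. (norm (\<Sum>j\<in>F. u j i *\<^sub>C C j (x m)))\<^sup>2) \<le> \<tau>\<^sup>2 * (\<Sum>k<n. (cmod (c k))\<^sup>2)" for m
    proof -
      have "(\<Sum>k<n. (\<Sum>j\<in>F. mat_tensor (\<alpha> j) (C j) i k) (c k *\<^sub>C x m)) = (\<Sum>j\<in>F. u j i *\<^sub>C C j (x m))" for i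
        using C by (simp add: column_apply[OF C] scaleC_scaleC u_def bounded_ops_def flip: scaleC_sum_left)
      then have "L2_set (\<lambda>i. norm (\<Sum>j\<in>F. u j i *\<^sub>C C j (x m))) {..<n} \<le> \<tau> * L2_set (\<lambda>k. cmod (c k)) {..<n}"
        using opmat_norm_upper[where T = "\<lambda>i k. \<Sum>j\<in>F. mat_tensor (\<alpha> j) (C j) i k" and x = "\<lambda>k. c k *\<^sub>C x m" and n = n]
        by (simp add: norm_scaleC x1 \<tau>_def)
      then have "(L2_set (\<lambda>i. norm (\<Sum>j\<in>F. u j i *\<^sub>C C j (x m))) {..<n})\<^sup>2 \<le> (\<tau> * L2_set (\<lambda>k. cmod (c k)) {..<n})\<^sup>2"
        by (rule power_mono) (rule L2_set_nonneg)
      then show ?thesis by (simp add: L2_set_sq power_mult_distrib)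
    qed
    ultimately have "(\<Sum>i<n. \<Sum>j\<in>F. (cmod (u j i))\<^sup>2) \<le> \<tau>\<^sup>2 * (\<Sum>k<n. (cmod (c k))\<^sup>2)"
      by (intro LIMSEQ_le_const2) auto
    moreover have "(\<Sum>i<n. \<Sum>j\<in>F. (cmod (u j i))\<^sup>2) = (\<Sum>p\<in>?P. (cmod (\<Sum>k<n. a p k * c k))\<^sup>2)"
      by (subst sum.swap) (simp add: sum.cartesian_product split_beta u_def a_def)
    ultimately show "(\<Sum>p\<in>?P. (cmod (\<Sum>k<n. a p k * c k))\<^sup>2) \<le> \<tau>\<^sup>2 * (\<Sum>k<n. (cmod (c k))\<^sup>2)"
      by simp
  qed simp
  with le show "(opmat_norm n (\<lambda>i k. \<Sum>j\<in>F. mat_tensor (\<alpha> j) (C j) i k))\<^sup>2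
      = cmat_norm n (\<lambda>i k. \<Sum>p\<in>?P. cnj (\<alpha> (fst p) (snd p) i) * \<alpha> (fst p) (snd p) k)"
    by (simp add: \<tau>_def \<beta>_def a_def)
qed


section \<open>From column orthogonality to the norms of the row and the column\<close>

text \<open>The coefficient matrices \<open>E\<^bsub>0,h j\<^esub>\<close> arrange the operators in a row, \<open>E\<^bsub>h j,0\<^esub>\<close> in a column.\<close>

lemma row_contraction_if_column_orthogonal:
  fixes C :: "'j \<Rightarrow> 'a::chilbert_space \<Rightarrow>\<^sub>L 'a"
  assumes C: "\<And>j. j \<in> F \<Longrightarrow> C j \<in> bounded_ops" and C1: "\<And>j. j \<in> F \<Longrightarrow> norm (C j) = 1"
    and F: "finite F" and col: "column_orthogonal_finite F C"
  shows "(norm (\<Sum>j\<in>F. C j (y j)))\<^sup>2 \<le> (\<Sum>j\<in>F. (norm (y j))\<^sup>2)"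
proof (cases "F = {}")
  case False
  define n where "n = card F"
  have n: "0 < n" using False F by (simp add: n_def card_gt_0_iff)
  obtain h where h: "bij_betw h F {..<n}"
    using ex_bij_betw_finite_nat[OF F] unfolding n_def atLeast0LessThan by blast
  have hlt: "h j < n" if "j \<in> F" for j using h that by (auto simp: bij_betw_def)
  \<comment> \<open>Here alpha_j^* alpha_j is the diagonal matrix unit at position h j, so the sum
    over F is the identity matrix of size n = card F; hence the bound 1 for
    \<open>\<tau>\<^sup>2\<close>.\<close>
  define \<alpha> :: "'j \<Rightarrow> nat \<Rightarrow> nat \<Rightarrow> complex" where "\<alpha> j i k = of_bool (i = 0 \<and> k = h j)" for j i k
  define \<tau> where "\<tau> = opmat_norm n (\<lambda>i k. \<Sum>j\<in>F. mat_tensor (\<alpha> j) (C j) i k)"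
  have eq: "\<tau>\<^sup>2 = cmat_norm n (\<lambda>i k. \<Sum>p\<in>F \<times> {..<n}. cnj (\<alpha> (fst p) (snd p) i) * \<alpha> (fst p) (snd p) k)"
    using col column_orthogonal_finite_iff[of F C] C1 unfolding \<tau>_def by blast
  have "\<tau>\<^sup>2 \<le> 1"
    unfolding eq
  proof (rule cmat_norm_gram_least)
    fix c :: "nat \<Rightarrow> complex"
    have "(\<Sum>i<n. (cmod (\<Sum>k<n. \<alpha> j i k * c k))\<^sup>2) = (cmod (c (h j)))\<^sup>2" if "j \<in> F" for j
    proof -
      have "(\<Sum>k<n. \<alpha> j i k * c k) = (\<Sum>k<n. if k = h j then (if i = 0 then c k else 0) else 0)" for i
        by (intro sum.cong) (auto simp: \<alpha>_def)
      then have "(\<Sum>k<n. \<alpha> j i k * c k) = (if i = 0 then c (h j) else 0)" for i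
        using hlt[OF that] by simp
      then have "(\<Sum>i<n. (cmod (\<Sum>k<n. \<alpha> j i k * c k))\<^sup>2) = (\<Sum>i<n. if i = 0 then (cmod (c (h j)))\<^sup>2 else 0)"
        by (intro sum.cong) auto
      then show ?thesis using n by simp
    qed
    then have "(\<Sum>j\<in>F. \<Sum>i<n. (cmod (\<Sum>k<n. \<alpha> j i k * c k))\<^sup>2) = (\<Sum>j\<in>F. (cmod (c (h j)))\<^sup>2)"
      by (rule sum.cong[OF refl])
    also have "\<dots> = (\<Sum>k<n. (cmod (c k))\<^sup>2)"
      by (rule sum.reindex_bij_betw[OF h])
    finally show "(\<Sum>p\<in>F \<times> {..<n}. (cmod (\<Sum>k<n. \<alpha> (fst p) (snd p) k * c k))\<^sup>2) \<le> 1 * (\<Sum>k<n. (cmod (c k))\<^sup>2)"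
      by (simp add: sum.cartesian_product split_beta)
  qed simp
  then have \<tau>: "\<tau> \<le> 1" by (simp add: abs_square_le_1)
  \<comment> \<open>\<open>x\<close> puts y_j into slot h j, so that row 0 of the operator matrix
    produces sum_j C_j y_j.\<close>
  define x where "x k = y (inv_into F h k)" for k
  have x: "x (h j) = y j" if "j \<in> F" for j
    using h that by (simp add: x_def bij_betw_def)
  have "(\<Sum>k<n. \<alpha> j 0 k *\<^sub>C x k) = y j" if "j \<in> F" for j
  proof -
    have "(\<Sum>k<n. \<alpha> j 0 k *\<^sub>C x k) = (\<Sum>k<n. if k = h j then x k else 0)"
      by (intro sum.cong) (auto simp: \<alpha>_def)
    then show ?thesis using hlt[OF that] x[OF that] by simp
  qed
  then have "norm (\<Sum>j\<in>F. C j (y j)) = norm (\<Sum>j\<in>F. C j (\<Sum>k<n. \<alpha> j 0 k *\<^sub>C x k))" by simp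
  also have "\<dots> \<le> L2_set (\<lambda>i. norm (\<Sum>j\<in>F. C j (\<Sum>k<n. \<alpha> j i k *\<^sub>C x k))) {..<n}"
    using n by (intro member_le_L2_set) auto
  also have "\<dots> \<le> \<tau> * L2_set (\<lambda>k. norm (x k)) {..<n}"
    using opmat_norm_upper[where T = "\<lambda>i k. \<Sum>j\<in>F. mat_tensor (\<alpha> j) (C j) i k" and n = n and x = x]
    by (simp add: column_apply[OF C] \<tau>_def)
  also have "\<dots> \<le> 1 * L2_set (\<lambda>k. norm (x k)) {..<n}"
    using \<tau> by (rule mult_right_mono) (rule L2_set_nonneg)
  finally have "(norm (\<Sum>j\<in>F. C j (y j)))\<^sup>2 \<le> (L2_set (\<lambda>k. norm (x k)) {..<n})\<^sup>2"
    by (simp add: power_mono)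
  also have "\<dots> = (\<Sum>j\<in>F. (norm (y j))\<^sup>2)"
    using sum.reindex_bij_betw[OF h, of "\<lambda>k. (norm (x k))\<^sup>2"] x by (simp add: L2_set_sq)
  finally show ?thesis .
qed simp

text \<open>Every alpha_j^* alpha_j equals the matrix unit E_00, so column orthogonality makes the
  squared norm of the column of the C_j equal to card F, while M bounds it from above.\<close>

lemma norming_sum_if_column_orthogonal:
  fixes C :: "'j \<Rightarrow> 'a::chilbert_space \<Rightarrow>\<^sub>L 'a"
  assumes C: "\<And>j. j \<in> F \<Longrightarrow> C j \<in> bounded_ops" and C1: "\<And>j. j \<in> F \<Longrightarrow> norm (C j) = 1"
    and F: "finite F" "F \<noteq> {}" and col: "column_orthogonal_finite F C"
    and M0: "0 \<le> M" and M: "\<And>x. (\<Sum>j\<in>F. (norm (C j x))\<^sup>2) \<le> M * (norm x)\<^sup>2"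
  shows "real (card F) \<le> M"
proof -
  define n where "n = card F"
  have n: "0 < n" using F by (simp add: n_def card_gt_0_iff)
  obtain h where h: "bij_betw h F {..<n}"
    using ex_bij_betw_finite_nat[OF F(1)] unfolding n_def atLeast0LessThan by blast
  have hlt: "h j < n" if "j \<in> F" for j using h that by (auto simp: bij_betw_def)
  define \<alpha> :: "'j \<Rightarrow> nat \<Rightarrow> nat \<Rightarrow> complex" where "\<alpha> j i k = of_bool (k = 0 \<and> i = h j)" for j i k
  define \<tau> where "\<tau> = opmat_norm n (\<lambda>i k. \<Sum>j\<in>F. mat_tensor (\<alpha> j) (C j) i k)"
  have eq: "\<tau>\<^sup>2 = cmat_norm n (\<lambda>i k. \<Sum>p\<in>F \<times> {..<n}. cnj (\<alpha> (fst p) (snd p) i) * \<alpha> (fst p) (snd p) k)"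
    using col column_orthogonal_finite_iff[of F C] C1 unfolding \<tau>_def by blast
  \<comment> \<open>The basis vector at index 0, where card F times E_00 attains its norm.\<close>
  define c :: "nat \<Rightarrow> complex" where "c k = of_bool (k = 0)" for k
  have "(\<Sum>i<n. (cmod (\<Sum>k<n. \<alpha> j i k * c k))\<^sup>2) = 1" if "j \<in> F" for j
  proof -
    have "(\<Sum>k<n. \<alpha> j i k * c k) = (\<Sum>k<n. if k = 0 then (if i = h j then 1 else 0) else 0)" for i
      by (intro sum.cong) (auto simp: \<alpha>_def c_def)
    then have "(\<Sum>k<n. \<alpha> j i k * c k) = (if i = h j then 1 else 0)" for i
      using n by simp
    then have "(\<Sum>i<n. (cmod (\<Sum>k<n. \<alpha> j i k * c k))\<^sup>2) = (\<Sum>i<n. if i = h j then 1 else 0)"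
      by (intro sum.cong) auto
    then show ?thesis using hlt[OF that] by simp
  qed
  then have "(\<Sum>j\<in>F. \<Sum>i<n. (cmod (\<Sum>k<n. \<alpha> j i k * c k))\<^sup>2) = (\<Sum>j\<in>F. 1)"
    by (rule sum.cong[OF refl])
  then have "real (card F) = (\<Sum>p\<in>F \<times> {..<n}. (cmod (\<Sum>k<n. \<alpha> (fst p) (snd p) k * c k))\<^sup>2)"
    by (simp add: sum.cartesian_product split_beta)
  also have "\<dots> \<le> \<tau>\<^sup>2 * (\<Sum>k<n. (cmod (c k))\<^sup>2)"
    unfolding eq by (rule cmat_norm_gram_upper)
  also have "(\<Sum>k<n. (cmod (c k))\<^sup>2) = (\<Sum>k<n. if k = 0 then 1 else 0)"
    by (intro sum.cong) (auto simp: c_def)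
  also have "\<dots> = 1" using n by simp
  finally have card: "real (card F) \<le> \<tau>\<^sup>2" by simp
  have "\<tau> \<le> sqrt M"
    unfolding \<tau>_def
  proof (rule opmat_norm_least)
    fix x :: "nat \<Rightarrow> 'a"
    \<comment> \<open>By injectivity of \<open>h\<close>, row h l of the operator matrix contains
      only C_l, in position 0; reindexing by \<open>h\<close> recovers the sum over F.\<close>
    have "(\<Sum>j\<in>F. C j (\<Sum>k<n. \<alpha> j (h l) k *\<^sub>C x k)) = C l (x 0)" if l: "l \<in> F" for l
    proof -
      have "(\<Sum>k<n. \<alpha> j (h l) k *\<^sub>C x k) = (if l = j then x 0 else 0)" if "j \<in> F" for j
      proof -
        have "(\<Sum>k<n. \<alpha> j (h l) k *\<^sub>C x k) = (\<Sum>k<n. if k = 0 then (if l = j then x 0 else 0) else 0)"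
          using h that l by (intro sum.cong) (auto simp: \<alpha>_def bij_betw_def inj_on_eq_iff)
        then show ?thesis using n by simp
      qed
      then have "(\<Sum>j\<in>F. C j (\<Sum>k<n. \<alpha> j (h l) k *\<^sub>C x k)) = (\<Sum>j\<in>F. if l = j then C j (x 0) else 0)"
        by (intro sum.cong) auto
      then show ?thesis using l F by simp
    qed
    then have "(\<Sum>i<n. (norm (\<Sum>j\<in>F. C j (\<Sum>k<n. \<alpha> j i k *\<^sub>C x k)))\<^sup>2) = (\<Sum>l\<in>F. (norm (C l (x 0)))\<^sup>2)"
      using sum.reindex_bij_betw[OF h, of "\<lambda>i. (norm (\<Sum>j\<in>F. C j (\<Sum>k<n. \<alpha> j i k *\<^sub>C x k)))\<^sup>2"] by simp
    also have "\<dots> \<le> M * (norm (x 0))\<^sup>2" by (rule M)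
    also have "\<dots> \<le> M * (\<Sum>k<n. (norm (x k))\<^sup>2)"
      using n by (intro mult_left_mono M0 member_le_sum) auto
    finally have "sqrt (\<Sum>i<n. (norm (\<Sum>j\<in>F. C j (\<Sum>k<n. \<alpha> j i k *\<^sub>C x k)))\<^sup>2)
        \<le> sqrt (M * (\<Sum>k<n. (norm (x k))\<^sup>2))" by (rule real_sqrt_le_mono)
    then show "L2_set (\<lambda>i. norm (\<Sum>k<n. (\<Sum>j\<in>F. mat_tensor (\<alpha> j) (C j) i k) (x k))) {..<n}
        \<le> sqrt M * L2_set (\<lambda>k. norm (x k)) {..<n}"
      by (simp add: column_apply[OF C] L2_set_def real_sqrt_mult)
  qed (simp add: M0)
  then have "\<tau>\<^sup>2 \<le> (sqrt M)\<^sup>2" by (rule power_mono) (simp add: \<tau>_def opmat_norm_nonneg)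
  with card M0 show ?thesis by simp
qed

section \<open>The equivalences and the cyclic representation\<close>

lemma jointly_norming_subset: "jointly_norming J C \<Longrightarrow> F \<subseteq> J \<Longrightarrow> jointly_norming F C"
  by (simp add: jointly_norming_def subset_trans[of _ F J])

text \<open>The nonzero vector matters for the empty subfamily, where \<open>jointly_norming\<close>
  still asks for a unit vector. States are kept out, since they are tied to
  \<open>jointly_norming\<close> independently of the row condition.\<close>

lemma column_orthogonal_iff:
  fixes C :: "'j \<Rightarrow> 'a::chilbert_space \<Rightarrow>\<^sub>L 'a"
  assumes ex: "\<exists>x::'a. x \<noteq> 0"
    and C: "\<And>j. j \<in> J \<Longrightarrow> C j \<in> bounded_ops" and C1: "\<And>j. j \<in> J \<Longrightarrow> norm (C j) = 1"
  shows "column_orthogonal J C \<longleftrightarrow>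
    (\<forall>F. finite F \<and> F \<subseteq> J \<longrightarrow> op_le (\<Sum>j\<in>F. C j o\<^sub>L adj (C j)) id_blinfun) \<and> jointly_norming J C"
proof (intro iffI conjI allI impI)
  assume col: "column_orthogonal J C"
  then have fin: "column_orthogonal_finite F C" if "finite F" "F \<subseteq> J" for F
    using that by (simp add: column_orthogonal_def)
  show "op_le (\<Sum>j\<in>F. C j o\<^sub>L adj (C j)) id_blinfun" if "finite F \<and> F \<subseteq> J" for F
  proof -
    have CF: "C j \<in> bounded_ops" "norm (C j) = 1" if "j \<in> F" for j
      using C C1 that \<open>finite F \<and> F \<subseteq> J\<close> by blast+
    have "(norm (\<Sum>j\<in>F. C j (y j)))\<^sup>2 \<le> (\<Sum>j\<in>F. (norm (y j))\<^sup>2)" for y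
      using that CF fin by (intro row_contraction_if_column_orthogonal) auto
    then show ?thesis
      using op_le_sum_adj_iff[of F C] row_contraction_iff[of F C] CF(1) by blast
  qed
  show "jointly_norming J C"
  proof (rule jointly_normingI[OF ex])
    fix F and e :: real assume F: "finite F" "F \<subseteq> J" "F \<noteq> {}" "e > 0"
    have CF: "C j \<in> bounded_ops" "norm (C j) = 1" if "j \<in> F" for j
      using C C1 that F by blast+
    show "\<exists>x. norm x \<le> 1 \<and> real (card F) - e < (\<Sum>j\<in>F. (norm (C j x))\<^sup>2)"
      using F(4)
    proof (rule norming_sum_vector)
      fix M :: real assume "0 \<le> M" "\<And>x. (\<Sum>j\<in>F. (norm (C j x))\<^sup>2) \<le> M * (norm x)\<^sup>2"
      then show "real (card F) \<le> M"
        using CF F fin by (intro norming_sum_if_column_orthogonal[of F C]) auto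
    qed
  qed (simp add: C1)
next
  assume A: "(\<forall>F. finite F \<and> F \<subseteq> J \<longrightarrow> op_le (\<Sum>j\<in>F. C j o\<^sub>L adj (C j)) id_blinfun) \<and> jointly_norming J C"
  have "column_orthogonal_finite F C" if F: "finite F" "F \<subseteq> J" for F
  proof (rule column_orthogonal_finite_if)
    show CF: "C j \<in> bounded_ops" "norm (C j) = 1" if "j \<in> F" for j
      using C C1 that F by blast+
    show "jointly_norming F C"
      using A F(2) jointly_norming_subset by blast
    show "(\<Sum>j\<in>F. (norm (adj (C j) w))\<^sup>2) \<le> (norm w)\<^sup>2" for w
    proof -
      have "op_le (\<Sum>j\<in>F. C j o\<^sub>L adj (C j)) id_blinfun" using A F by simp
      then show ?thesis using op_le_sum_adj_iff[of F C] CF(1) by simp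
    qed
  qed (rule F)
  then show "column_orthogonal J C" by (simp add: column_orthogonal_def)
qed

text \<open>omega(T^* T) = |pi(T) eta|^2, and |pi(T) eta| <= |pi(T)| <= 1 by contractivity; so the
  value 1 at the unit vector eta forces the operator norm to be 1 as well.\<close>

lemma cyclic_representation_norm_one_iff:
  fixes \<pi> :: "('a::chilbert_space \<Rightarrow>\<^sub>L 'a) \<Rightarrow> ('h::chilbert_space \<Rightarrow>\<^sub>L 'h)"
  assumes A: "cstar_subalgebra A" and cyc: "cyclic_representation_of A \<omega> \<pi> \<eta>"
    and T: "T \<in> A" "norm T \<le> 1"
  shows "\<omega> (adj T o\<^sub>L T) = 1 \<longleftrightarrow> norm (\<pi> T) = 1 \<and> norm (\<pi> T \<eta>) = 1"
proof -
  have \<pi>: "representation A \<pi>" and \<eta>: "norm \<eta> = 1" and \<omega>: "\<And>S. S \<in> A \<Longrightarrow> \<omega> S = cinner (\<pi> S \<eta>) \<eta>"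
    using cyc by (auto simp: cyclic_representation_of_def)
  have "adj T o\<^sub>L T \<in> A" "adj T \<in> A" using T by (simp_all add: cstar_subalgebraD[OF A])
  then have "\<omega> (adj T o\<^sub>L T) = cinner ((adj (\<pi> T) o\<^sub>L \<pi> T) \<eta>) \<eta>"
    using \<pi> T(1) by (simp add: \<omega> representation_def)
  also have "\<dots> = complex_of_real ((norm (\<pi> T \<eta>))\<^sup>2)"
    using \<pi> T(1) by (intro cinner_adj_compose) (simp add: representation_def)
  finally have "\<omega> (adj T o\<^sub>L T) = 1 \<longleftrightarrow> (norm (\<pi> T \<eta>))\<^sup>2 = 1"
    by (simp only: of_real_eq_1_iff)
  also have "\<dots> \<longleftrightarrow> norm (\<pi> T \<eta>) = 1"
    by (simp add: power2_eq_1_iff) (metis norm_ge_zero not_one_le_zero neg_0_le_iff_le)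
  finally have "\<omega> (adj T o\<^sub>L T) = 1 \<longleftrightarrow> norm (\<pi> T \<eta>) = 1" .
  moreover have "norm (\<pi> T) \<le> 1" using A \<pi> T by (rule representation_contractive)
  moreover have "norm (\<pi> T \<eta>) \<le> norm (\<pi> T)" using norm_blinfun[of "\<pi> T" \<eta>] \<eta> by simp
  ultimately show ?thesis by linarith
qed

theorem theorem4p3:
  fixes J :: "'j set"
    and C :: "'j \<Rightarrow> ('a::chilbert_space \<Rightarrow>\<^sub>L 'a)"
  assumes "\<exists>x::'a. x \<noteq> 0"
    and "\<And>j. j \<in> J \<Longrightarrow> C j \<in> bounded_ops"
    and "\<And>j. j \<in> J \<Longrightarrow> norm (C j) = 1"
  shows
    "(column_orthogonal J C \<longleftrightarrow>
        (\<forall>F. finite F \<and> F \<subseteq> J \<longrightarrow> op_le (\<Sum>j\<in>F. C j o\<^sub>L adj (C j)) id_blinfun) \<and>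
        (\<exists>\<omega>. is_state bounded_ops \<omega> \<and> (\<forall>j\<in>J. \<omega> (adj (C j) o\<^sub>L C j) = 1)))
     \<and> (J \<noteq> {} \<longrightarrow>
        ((\<exists>\<omega>. is_state bounded_ops \<omega> \<and> (\<forall>j\<in>J. \<omega> (adj (C j) o\<^sub>L C j) = 1)) \<longleftrightarrow>
         (\<exists>\<omega>. is_state (cstar_generated (C ` J)) \<omega> \<and> (\<forall>j\<in>J. \<omega> (adj (C j) o\<^sub>L C j) = 1))))
     \<and> (\<forall>A \<in> {bounded_ops, cstar_generated (C ` J)}.
        \<forall>\<omega> (\<pi> :: ('a \<Rightarrow>\<^sub>L 'a) \<Rightarrow> ('h::chilbert_space \<Rightarrow>\<^sub>L 'h)) \<eta>.
          is_state A \<omega> \<and> cyclic_representation_of A \<omega> \<pi> \<eta> \<longrightarrow>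
          ((\<forall>j\<in>J. \<omega> (adj (C j) o\<^sub>L C j) = 1) \<longleftrightarrow>
           (\<forall>j\<in>J. norm (\<pi> (C j)) = 1 \<and> norm (\<pi> (C j) \<eta>) = 1)))"
proof -
  let ?state = "\<lambda>A. \<exists>\<omega>. is_state A \<omega> \<and> (\<forall>j\<in>J. \<omega> (adj (C j) o\<^sub>L C j) = 1)"
  let ?G = "cstar_generated (C ` J)"
  have le1: "norm (C j) \<le> 1" if "j \<in> J" for j using assms(3)[OF that] by simp
  have CB: "C ` J \<subseteq> bounded_ops" using assms(2) by blast
  have alg: "cstar_subalgebra A \<and> C ` J \<subseteq> A" if "A \<in> {bounded_ops, ?G}" for A
    using that cstar_subalgebra_bounded_ops CB cstar_subalgebra_generated[OF CB]
      cstar_generated_superset[of "C ` J"] by auto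
  have jn: "jointly_norming J C" if "?state A" "A \<in> {bounded_ops, ?G}" for A
    using that(1) alg[OF that(2)] le1 by (blast intro: jointly_norming_if_state[OF assms(1)])
  have "?state bounded_ops" if "jointly_norming J C"
    using that assms(2) le1 by (rule state_if_jointly_norming)
  then have state_iff: "jointly_norming J C \<longleftrightarrow> ?state bounded_ops"
    using jn[of bounded_ops] by (intro iffI) simp_all
  \<comment> \<open>For empty \<open>J\<close> the generated algebra is {0}, which carries no state.
    Otherwise some C_j^* C_j is an element of norm at most 1 at which the restricted state still has
    the value 1.\<close>
  have restrict: "?state ?G" if "J \<noteq> {}" and B: "?state bounded_ops"
  proof -
    obtain j where j: "j \<in> J" using \<open>J \<noteq> {}\<close> by blast
    obtain \<omega> where \<omega>: "is_state bounded_ops \<omega>" "\<forall>j\<in>J. \<omega> (adj (C j) o\<^sub>L C j) = 1" using B by blast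
    have "is_state ?G \<omega>"
    proof (rule is_state_restrict[OF \<omega>(1) cstar_generated_subset_bounded_ops[OF CB]])
      show "adj (C j) o\<^sub>L C j \<in> ?G" using alg[of ?G] j by (auto simp: cstar_subalgebraD)
      show "norm (adj (C j) o\<^sub>L C j) \<le> 1"
        using norm_adj_compose_le[OF assms(2)[OF j]] assms(3)[OF j] by simp
    qed (use \<omega> j in blast)
    then show ?thesis using \<omega>(2) by blast
  qed
  have rep: "(\<forall>j\<in>J. \<omega> (adj (C j) o\<^sub>L C j) = 1) \<longleftrightarrow>
      (\<forall>j\<in>J. norm (\<pi> (C j)) = 1 \<and> norm (\<pi> (C j) \<eta>) = 1)"
    if "A \<in> {bounded_ops, ?G}" "cyclic_representation_of A \<omega> \<pi> \<eta>"
    for A \<omega> \<eta> and \<pi> :: "('a \<Rightarrow>\<^sub>L 'a) \<Rightarrow> ('h \<Rightarrow>\<^sub>L 'h)"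
  proof (rule ball_cong[OF refl])
    fix j assume "j \<in> J"
    with alg[OF that(1)] le1 show "\<omega> (adj (C j) o\<^sub>L C j) = 1 \<longleftrightarrow> norm (\<pi> (C j)) = 1 \<and> norm (\<pi> (C j) \<eta>) = 1"
      by (intro cyclic_representation_norm_one_iff[OF _ that(2)]) auto
  qed
  have col: "column_orthogonal J C \<longleftrightarrow>
      (\<forall>F. finite F \<and> F \<subseteq> J \<longrightarrow> op_le (\<Sum>j\<in>F. C j o\<^sub>L adj (C j)) id_blinfun) \<and> ?state bounded_ops"
    using assms unfolding state_iff[symmetric] by (rule column_orthogonal_iff)
  \<comment> \<open>No functional is extended: a state on the generated algebra yields norming
    vectors, and these yield a possibly different state on B(K).\<close>
  have extend: "?state bounded_ops" if "?state ?G"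
    using jn[OF that] state_iff by simp
  show ?thesis
  proof (intro conjI impI ballI allI)
    show "?state bounded_ops \<longleftrightarrow> ?state ?G" if "J \<noteq> {}"
      using restrict[OF that] extend by (rule iffI)
    show "(\<forall>j\<in>J. \<omega> (adj (C j) o\<^sub>L C j) = 1) \<longleftrightarrow>
        (\<forall>j\<in>J. norm (\<pi> (C j)) = 1 \<and> norm (\<pi> (C j) \<eta>) = 1)"
      if "A \<in> {bounded_ops, ?G}" "is_state A \<omega> \<and> cyclic_representation_of A \<omega> \<pi> \<eta>"
      for A \<omega> \<eta> and \<pi> :: "('a \<Rightarrow>\<^sub>L 'a) \<Rightarrow> ('h \<Rightarrow>\<^sub>L 'h)"
      using that(1) conjunct2[OF that(2)] by (rule rep)
  qed (rule col)
qed

end
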